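(* Let $\epsilon(\cdot)$ be the Fröhlich–Spencer correction function described in the context. If $\beta$ is large enough, then $$\frac{\beta}{1+\epsilon(\beta)}\ \le\ \hat\beta_{eff}(\beta)\ \le\ \frac{\beta}{1+M(\beta)/2}\ \le\ \beta-\tfrac12\beta^2\exp\Big(-\frac{(2\pi)^2}{2}\beta\Big).$$
   Context: Villain model. On a finite graph with vertex set $V$, edge set $E$ and marked vertex $v_0$, the Villain model at inverse temperature $\beta$ is the random $\theta:V\to[0,2\pi)$, $\theta(v_0)=0$, with density proportional to $\prod_{\{x,y\}\in E}\sum_{k\in\mathbb Z}\exp(-\frac\beta2(\theta(x)-\theta(y)+2\pi k)^2)$. Here $\mathbb E^{Vil}_\beta$ denotes expectation under the unique translation invariant infinite-volume Gibbs state on $\mathbb Z^2$ (limit of the models on the boxes $[-n,n]^2\cap\mathbb Z^2$). Effective inverse temperature: $$\hat\beta_{eff}=\hat\beta_{eff}(\beta):=\frac1{2\pi}\limsup_{\|v\|_2\to\infty}\frac{\log\|v\|_2}{\log\big(\mathbb E^{Vil}_\beta[\cos(\theta_0-\theta_v)]^{-1}\big)}.$$ Fröhlich–Spencer function: by a theorem of Fröhlich and Spencer there exist $\beta_0<\infty$ and a function $\epsilon(\beta)=o(1)$ as $\beta\to\infty$ such that for every $\beta\ge\beta_0$ there is a constant $K>0$ with $\mathbb E^{Vil}_\beta[\cos(\theta(0)-\theta(v))]\ge K^{-1}\|v\|_2^{-\frac{1+\epsilon(\beta)}{2\pi\beta}}$ for all $v\in\mathbb Z^2\setminus\{0\}$;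 $\epsilon(\cdot)$ is such a function. Error function. An integer-valued Gaussian with parameters $(a,\beta)$ is a $\mathbb Z$-valued $X$ with $\mathbb P^{IG}_{\beta,a}[X=k]\propto e^{-\frac\beta2(k-a)^2}$; $\operatorname{Var}^{IG}(a,\beta)$ is its variance. $M(\beta):=(2\pi)^2\beta\inf_{a\in[0,1/2]}\operatorname{Var}^{IG}(a,(2\pi)^2\beta)$. *)

theory Defs
  imports "HOL-Probability.Probability"
begin

section \<open>The Villain model on a finite graph\<close>

definition villain_weight :: "real \<Rightarrow> real \<Rightarrow> real" where
  "villain_weight \<beta> t = (\<Sum>\<^sub>\<infinity>k\<in>(UNIV :: int set). exp (- (\<beta> / 2) * (t + 2 * pi * of_int k)\<^sup>2))"

lemma villain_weight_minus: "villain_weight \<beta> (- t) = villain_weight \<beta> t"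
  unfolding villain_weight_def
  by (rule infsum_reindex_bij_witness[of _ uminus uminus]) (auto simp: power2_eq_square algebra_simps)

text \<open>
  Edges are unordered pairs \<open>{x, y}\<close>.  As the weight is even, the factor of an edge does not depend
  on the order of its endpoints; see \<open>villain_edge_pair\<close>.
\<close>

definition villain_edge :: "real \<Rightarrow> ('v \<Rightarrow> real) \<Rightarrow> 'v set \<Rightarrow> real" where
  "villain_edge \<beta> \<theta> e = (THE w. \<exists>x y. e = {x, y} \<and> w = villain_weight \<beta> (\<theta> x - \<theta> y))"

lemma villain_edge_pair: "villain_edge \<beta> \<theta> {x, y} = villain_weight \<beta> (\<theta> x - \<theta> y)"
  unfolding villain_edge_def
proof (rule the_equality)
  fix w assume "\<exists>x' y'. {x, y} = {x', y'} \<and> w = villain_weight \<beta> (\<theta> x' - \<theta> y')"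
  then show "w = villain_weight \<beta> (\<theta> x - \<theta> y)"
    using villain_weight_minus[of \<beta> "\<theta> x - \<theta> y"] by (auto simp: doubleton_eq_iff)
qed blast

definition normalised_density :: "'a measure \<Rightarrow> ('a \<Rightarrow> real) \<Rightarrow> 'a measure" where
  "normalised_density M w = density M (\<lambda>\<theta>. ennreal (w \<theta> / (\<integral>\<eta>. w \<eta> \<partial>M)))"

abbreviation uniform_angle :: "real measure" where
  "uniform_angle \<equiv> uniform_measure lborel {0..<2 * pi}"

definition villain_model :: "'v set \<Rightarrow> 'v set set \<Rightarrow> 'v \<Rightarrow> real \<Rightarrow> ('v \<Rightarrow> real) measure" where
  "villain_model V E v\<^sub>0 \<beta> =
     normalised_density
       (PiM V (\<lambda>x. if x = v\<^sub>0 then return borel 0 else uniform_angle))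
       (\<lambda>\<theta>. \<Prod>e\<in>E. villain_edge \<beta> \<theta> e)"


section \<open>The infinite-volume state on the square lattice\<close>

type_synonym site = "int \<times> int"

definition lattice_norm :: "site \<Rightarrow> real" where
  "lattice_norm v = sqrt ((real_of_int (fst v))\<^sup>2 + (real_of_int (snd v))\<^sup>2)"

definition lattice_edges :: "site set set" where
  "lattice_edges = {{x, y} | x y. \<bar>fst x - fst y\<bar> + \<bar>snd x - snd y\<bar> = 1}"

definition box :: "nat \<Rightarrow> site set" where
  "box n = {- int n..int n} \<times> {- int n..int n}"

definition villain_box :: "nat \<Rightarrow> real \<Rightarrow> (site \<Rightarrow> real) measure" where
  "villain_box n \<beta> = villain_model (box n) {e \<in> lattice_edges. e \<subseteq> box n} 0 \<beta>"

definition config_space :: "(site \<Rightarrow> real) measure" where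
  "config_space = PiM UNIV (\<lambda>_. borel)"

text \<open>
  The finite-volume specification: the law of the configuration when the angles outside \<open>\<Lambda>\<close> are
  frozen to those of \<open>\<eta>\<close>.  No vertex is pinned here.
\<close>

definition villain_kernel :: "real \<Rightarrow> site set \<Rightarrow> (site \<Rightarrow> real) \<Rightarrow> (site \<Rightarrow> real) measure" where
  "villain_kernel \<beta> \<Lambda> \<eta> =
     distr
       (normalised_density (PiM \<Lambda> (\<lambda>_. uniform_angle))
         (\<lambda>\<theta>. \<Prod>e\<in>{e \<in> lattice_edges. e \<inter> \<Lambda> \<noteq> {}}. villain_edge \<beta> (merge \<Lambda> (- \<Lambda>) (\<theta>, \<eta>)) e))
       config_space (\<lambda>\<theta>. merge \<Lambda> (- \<Lambda>) (\<theta>, \<eta>))"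

definition villain_gibbs_measure :: "real \<Rightarrow> (site \<Rightarrow> real) measure \<Rightarrow> bool" where
  "villain_gibbs_measure \<beta> \<mu> \<longleftrightarrow>
     prob_space \<mu> \<and> sets \<mu> = sets config_space \<and>
     (AE \<theta> in \<mu>. \<forall>x. \<theta> x \<in> {0..<2 * pi}) \<and>
     (\<forall>\<Lambda>. finite \<Lambda> \<longrightarrow>
        (\<forall>A\<in>sets config_space. emeasure \<mu> A = (\<integral>\<^sup>+\<eta>. emeasure (villain_kernel \<beta> \<Lambda> \<eta>) A \<partial>\<mu>)))"

definition translation_invariant :: "(site \<Rightarrow> real) measure \<Rightarrow> bool" where
  "translation_invariant \<mu> \<longleftrightarrow> (\<forall>a. distr \<mu> config_space (\<lambda>\<theta> x. \<theta> (x + a)) = \<mu>)"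

text \<open>
  The box models are pinned at the origin, whereas a translation invariant state cannot be.  Both
  are therefore compared through the rotation invariant configuration \<open>x \<mapsto> exp (i (\<theta> x - \<theta> 0))\<close>;
  convergence is tested on continuous functions that depend on finitely many sites.
\<close>

definition limit_of_boxes :: "real \<Rightarrow> (site \<Rightarrow> real) measure \<Rightarrow> bool" where
  "limit_of_boxes \<beta> \<mu> \<longleftrightarrow>
     (\<forall>A (f :: (site \<Rightarrow> complex) \<Rightarrow> real).
        finite A \<and> continuous_on UNIV f \<and> (\<forall>z w. (\<forall>x\<in>A. z x = w x) \<longrightarrow> f z = f w) \<longrightarrow>
        (\<lambda>n. \<integral>\<theta>. f (\<lambda>x. cis (\<theta> x - \<theta> 0)) \<partial>villain_box n \<beta>)
          \<longlonglongrightarrow> (\<integral>\<theta>. f (\<lambda>x. cis (\<theta> x - \<theta> 0)) \<partial>\<mu>))"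

text \<open>
  Everything below depends on \<open>\<mu>\<close> only through the correlations \<open>\<integral> cos (\<theta> 0 - \<theta> v) d\<mu>\<close>,
  which the third clause determines uniquely.
\<close>

definition villain_state :: "real \<Rightarrow> (site \<Rightarrow> real) measure \<Rightarrow> bool" where
  "villain_state \<beta> \<mu> \<longleftrightarrow>
     villain_gibbs_measure \<beta> \<mu> \<and> translation_invariant \<mu> \<and> limit_of_boxes \<beta> \<mu>"

definition spin_correlation :: "(site \<Rightarrow> real) measure \<Rightarrow> site \<Rightarrow> real" where
  "spin_correlation \<mu> v = (\<integral>\<theta>. cos (\<theta> 0 - \<theta> v) \<partial>\<mu>)"

definition effective_inverse_temperature :: "(site \<Rightarrow> real) measure \<Rightarrow> ereal" where
  "effective_inverse_temperature \<mu> =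
     ereal (1 / (2 * pi)) *
     Limsup (filtercomap lattice_norm at_top)
       (\<lambda>v. ereal (ln (lattice_norm v) / ln (inverse (spin_correlation \<mu> v))))"

definition frohlich_spencer_function ::
    "(real \<Rightarrow> (site \<Rightarrow> real) measure) \<Rightarrow> (real \<Rightarrow> real) \<Rightarrow> bool" where
  "frohlich_spencer_function \<mu> \<epsilon> \<longleftrightarrow>
     (\<epsilon> \<longlongrightarrow> 0) at_top \<and>
     (\<exists>\<beta>\<^sub>0>0. \<forall>\<beta>\<ge>\<beta>\<^sub>0. \<exists>K>0. \<forall>v. v \<noteq> 0 \<longrightarrow>
        spin_correlation (\<mu> \<beta>) v \<ge> inverse K * lattice_norm v powr (- ((1 + \<epsilon> \<beta>) / (2 * pi * \<beta>))))"


section \<open>The integer-valued Gaussian and the error function\<close>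

definition integer_gaussian :: "real \<Rightarrow> real \<Rightarrow> int pmf" where
  "integer_gaussian a \<beta> =
     embed_pmf (\<lambda>k. exp (- (\<beta> / 2) * (of_int k - a)\<^sup>2) /
                    (\<Sum>\<^sub>\<infinity>j\<in>(UNIV :: int set). exp (- (\<beta> / 2) * (of_int j - a)\<^sup>2)))"

lemma integer_gaussian_summable:
  fixes a \<beta> :: real
  assumes "\<beta> > 0"
  shows "(\<lambda>k::int. exp (- (\<beta> / 2) * (of_int k - a)\<^sup>2)) summable_on UNIV"
proof -
  define r where "r = exp (- (\<beta> / 2))"
  define C where "C = exp (\<beta> / 2 * (\<bar>a\<bar> + 1 / 4))"
  have r: "0 < r" "r < 1"
    using assms by (auto simp: r_def)
  have nat: "(\<lambda>n::nat. r ^ n) summable_on UNIV"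
    by (rule norm_summable_imp_summable_on) (use r in \<open>simp add: summable_geometric\<close>)
  have pos: "(\<lambda>k::int. r ^ nat \<bar>k\<bar>) summable_on range int"
    by (subst summable_on_reindex) (use nat in \<open>auto simp: o_def\<close>)
  have neg: "(\<lambda>k::int. r ^ nat \<bar>k\<bar>) summable_on range (\<lambda>n. - int n)"
    by (subst summable_on_reindex) (use nat in \<open>auto simp: o_def inj_on_def\<close>)
  have "(\<lambda>k::int. r ^ nat \<bar>k\<bar>) summable_on (range int \<union> (range (\<lambda>n. - int n) - range int))"
    by (rule summable_on_Un_disjoint[OF pos summable_on_subset_banach[OF neg]]) auto
  also have "range int \<union> (range (\<lambda>n. - int n) - range int) = UNIV"
  proof -
    have "k \<in> range int \<union> range (\<lambda>n. - int n)" for k :: int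
      by (cases k rule: int_cases2) auto
    then show ?thesis by blast
  qed
  finally have "(\<lambda>k::int. C * r ^ nat \<bar>k\<bar>) summable_on UNIV"
    by (rule summable_on_cmult_right)
  then show ?thesis
  proof (rule summable_on_comparison_test)
    fix k :: int
    have "(\<bar>of_int k - a\<bar> - 1 / 2)\<^sup>2 \<ge> 0" by simp
    then have "(of_int k - a)\<^sup>2 \<ge> \<bar>of_int k - a\<bar> - 1 / 4"
      unfolding power2_diff power2_abs by (simp add: power2_eq_square)
    then have "(of_int k - a)\<^sup>2 \<ge> \<bar>of_int k\<bar> - (\<bar>a\<bar> + 1 / 4)"
      by linarith
    then have "\<beta> / 2 * (\<bar>of_int k\<bar> - (\<bar>a\<bar> + 1 / 4)) \<le> \<beta> / 2 * (of_int k - a)\<^sup>2"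
      using assms by (intro mult_left_mono) auto
    then have "exp (- (\<beta> / 2) * (of_int k - a)\<^sup>2)
        \<le> exp (\<beta> / 2 * (\<bar>a\<bar> + 1 / 4) + real (nat \<bar>k\<bar>) * (- (\<beta> / 2)))"
      by (simp add: algebra_simps)
    also have "\<dots> = C * r ^ nat \<bar>k\<bar>"
      unfolding C_def r_def by (simp only: exp_add exp_of_nat_mult)
    finally show "exp (- (\<beta> / 2) * (of_int k - a)\<^sup>2) \<le> C * r ^ nat \<bar>k\<bar>" .
  qed simp
qed

lemma pmf_integer_gaussian:
  assumes "\<beta> > 0"
  shows "pmf (integer_gaussian a \<beta>) k =
     exp (- (\<beta> / 2) * (of_int k - a)\<^sup>2) /
     (\<Sum>\<^sub>\<infinity>j\<in>(UNIV :: int set). exp (- (\<beta> / 2) * (of_int j - a)\<^sup>2))"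
proof -
  define g where "g = (\<lambda>k::int. exp (- (\<beta> / 2) * (of_int k - a)\<^sup>2))"
  define Z where "Z = infsum g UNIV"
  have summable: "g summable_on UNIV"
    unfolding g_def by (rule integer_gaussian_summable[OF assms])
  have "g 0 \<le> Z"
    unfolding Z_def using infsum_mono_neutral[of g "{0}" g UNIV] summable by (auto simp: g_def)
  then have "Z > 0"
    by (smt (verit) exp_gt_zero g_def)
  have nonneg: "0 \<le> g k / Z" for k
    using \<open>Z > 0\<close> by (simp add: g_def)
  have sums: "(\<lambda>k. g k / Z) summable_on UNIV"
    using summable_on_cmult_right[OF summable, of "inverse Z"] by (simp add: field_simps)
  have abs: "Infinite_Set_Sum.abs_summable_on (\<lambda>k. g k / Z) UNIV"
    unfolding abs_summable_equivalent[symmetric] real_norm_def abs_of_nonneg[OF nonneg] by (rule sums)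
  have "infsum (\<lambda>k. g k / Z) UNIV = inverse Z * Z"
    unfolding Z_def by (subst infsum_cmult_right'[symmetric]) (simp add: field_simps)
  then have "(\<integral>\<^sup>+k. ennreal (g k / Z) \<partial>count_space UNIV) = 1"
    using nn_integral_conv_infsetsum[OF abs] infsetsum_infsum[OF abs] nonneg \<open>Z > 0\<close> by simp
  then have "pmf (embed_pmf (\<lambda>k. g k / Z)) k = g k / Z"
    using nonneg by (intro pmf_embed_pmf) auto
  then show ?thesis
    by (simp add: integer_gaussian_def g_def Z_def)
qed

definition Var_IG :: "real \<Rightarrow> real \<Rightarrow> real" where
  "Var_IG a \<beta> = measure_pmf.variance (integer_gaussian a \<beta>) real_of_int"

definition M_error :: "real \<Rightarrow> real" where
  "M_error \<beta> = (2 * pi)\<^sup>2 * \<beta> * (INF a\<in>{0..1/2}. Var_IG a ((2 * pi)\<^sup>2 * \<beta>))"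

end

theory Submission
  imports Defs "HOL-Complex_Analysis.Complex_Analysis" "HOL-Real_Asymp.Real_Asymp"
begin

text \<open>
  The upper bound on the correlations is obtained by a McBryan--Spencer contour shift
  \<open>\<theta> \<mapsto> \<theta> + i h\<close> in the finite box, with \<open>h\<close> a multiple of a truncated lattice logarithm. An edge
  along which \<open>h\<close> increases by \<open>s\<close> contributes the Gaussian cost \<open>exp (\<beta> s\<^sup>2 / 2)\<close> times the characteristic
  function at \<open>2 \<pi> \<beta> s\<close> of an integer Gaussian with parameter \<open>(2 \<pi>)\<^sup>2 \<beta>\<close>, whose centre is determined by
  the angles. Bounding this characteristic function uniformly in the centre by
  \<open>exp (- (2 \<pi> \<beta> s)\<^sup>2 V / 4)\<close>, where \<open>V\<close> is the minimal variance, turns the Gaussian cost into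
  \<open>exp (\<beta> s\<^sup>2 (1 - M / 2) / 2)\<close>. Since the truncated logarithm has Dirichlet energy
  \<open>(2 \<pi> + o(1)) ln |v|\<close>, optimising the multiple gives the decay exponent \<open>(1 + M / 2) / (2 \<pi> \<beta>)\<close>.
\<close>

section \<open>Integer-valued Gaussians\<close>

text \<open>The exponent that a test function yields is governed by the square of its gain divided
  by its energy. One truncated logarithm around \<open>0\<close> gains \<open>ln |v|\<close> at
  energy about \<open>2 pi ln |v|\<close>, hence only half of the claimed exponent. The test
  function is therefore a dipole: a logarithm around \<open>0\<close> minus its copy around
  \<open>v\<close>, cut off so that the two gradients have disjoint support. Gain and energy both
  double, and so does the exponent. The obstacle is that the bound on the characteristic function is
  proved only for arguments up to 1, while the chosen multiple makes the argument at an edge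
  comparable with the slope of the lattice logarithm. The logarithm is therefore flattened near its
  centre, which costs bounded terms only. A Gaussian would have \<open>V / 2\<close> in the
  exponent; asking for \<open>V / 4\<close> is the source of \<open>M / 2\<close> and leaves room
  for crude constants. The relative error of the energy estimate is carried as a factor
  \<open>\<rho> < 1\<close> and removed after the limit superior.\<close>

lemma has_sum_power_nat_abs:
  fixes x :: real
  assumes "0 \<le> x" "x < 1"
  shows "((\<lambda>k::int. x ^ nat \<bar>k\<bar>) has_sum (1 + x) / (1 - x)) UNIV"
proof -
  have geo: "((\<lambda>n. x ^ n) has_sum 1 / (1 - x)) UNIV"
    by (rule norm_summable_imp_has_sum) (use assms geometric_sums[of x] in \<open>auto simp: summable_geometric\<close>)
  have pos: "((\<lambda>k::int. x ^ nat \<bar>k\<bar>) has_sum 1 / (1 - x)) (range int)"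
    by (subst has_sum_reindex) (use geo in \<open>auto simp: o_def\<close>)
  have neg: "((\<lambda>k::int. x ^ nat \<bar>k\<bar>) has_sum x * (1 / (1 - x))) (range (\<lambda>n. - int (Suc n)))"
  proof (subst has_sum_reindex)
    have "nat \<bar>- int (Suc n)\<bar> = Suc n" for n
      by simp
    then have "(\<lambda>k::int. x ^ nat \<bar>k\<bar>) \<circ> (\<lambda>n. - int (Suc n)) = (\<lambda>n. x * x ^ n)"
      unfolding o_def by (metis power_Suc)
    then show "(((\<lambda>k::int. x ^ nat \<bar>k\<bar>) \<circ> (\<lambda>n. - int (Suc n))) has_sum x * (1 / (1 - x))) UNIV"
      using has_sum_cmult_right[OF geo, of x] by simp
  qed (auto simp: inj_on_def)
  have "range int \<union> range (\<lambda>n. - int (Suc n)) = UNIV"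
  proof -
    have "k \<in> range int \<union> range (\<lambda>n. - int (Suc n))" for k :: int
      by (cases k rule: int_cases) auto
    then show ?thesis by blast
  qed
  moreover have "range int \<inter> range (\<lambda>n. - int (Suc n)) = {}"
    by auto
  ultimately show ?thesis
    using has_sum_Un_disjoint[OF pos neg] by (simp add: add_divide_distrib)
qed

text \<open>With \<open>y = \<bar>t\<bar> / 2\<close>, squaring \<open>y * cos y \<le> sin y\<close>
  gives \<open>y\<^sup>2 \<le> (sin y)\<^sup>2 * (1 + y\<^sup>2)\<close>, and
  \<open>1 + y\<^sup>2 \<le> 5 / 4\<close>; then \<open>1 - cos t\<close> is twice the square of
  \<open>sin y\<close>.\<close>

lemma one_minus_cos_ge:
  fixes t :: real
  assumes "\<bar>t\<bar> \<le> 1"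
  shows "2 / 5 * t\<^sup>2 \<le> 1 - cos t"
proof -
  define y where "y = \<bar>t\<bar> / 2"
  have y: "0 \<le> y" "y \<le> 1 / 2" using assms by (auto simp: y_def)
  have deriv: "\<exists>d. ((\<lambda>z. sin z - z * cos z) has_real_derivative d) (at z) \<and> 0 \<le> d"
    if "0 \<le> z" "z \<le> y" for z
  proof (intro exI conjI)
    show "((\<lambda>z. sin z - z * cos z) has_real_derivative z * sin z) (at z)"
      by (auto intro!: derivative_eq_intros)
    show "0 \<le> z * sin z"
      using that y pi_gt3 by (intro mult_nonneg_nonneg sin_ge_zero) auto
  qed
  have "sin 0 - 0 * cos 0 \<le> sin y - y * cos y"
    by (rule DERIV_nonneg_imp_nondecreasing[OF y(1)]) (use deriv in blast)
  then have "y * cos y \<le> sin y" by simp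
  moreover have "0 \<le> y * cos y"
    using y pi_gt3 by (intro mult_nonneg_nonneg cos_ge_zero) auto
  ultimately have "(y * cos y)\<^sup>2 \<le> (sin y)\<^sup>2"
    by (rule power_mono)
  then have "y\<^sup>2 \<le> (sin y)\<^sup>2 * (1 + y\<^sup>2)"
    unfolding power_mult_distrib cos_squared_eq by (simp add: algebra_simps)
  also have "\<dots> \<le> (sin y)\<^sup>2 * (1 + 1 / 4)"
    using power_mono[OF y(2,1), of 2] by (intro mult_left_mono) (auto simp: power2_eq_square)
  finally have "4 / 5 * y\<^sup>2 \<le> (sin y)\<^sup>2" by simp
  moreover have "cos t = 1 - 2 * (sin y)\<^sup>2"
    using cos_double_sin[of y] by (simp add: y_def)
  ultimately show ?thesis
    by (simp add: y_def power_divide)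
qed

text \<open>The squared modulus is the squared total mass minus \<open>2 * u\<close> minus a
  nonnegative interaction of the two outer weights, which is dropped. Completing the square removes
  the root.\<close>

lemma cmod_three_point_le:
  fixes A B C t :: real
  assumes "0 < A" "0 \<le> B" "0 \<le> C"
  shows "cmod (of_real A + of_real B * cis t + of_real C * cis (- t))
    \<le> (A + B + C) - A * (B + C) * (1 - cos t) / (A + B + C)"
proof -
  define S u where "S = A + B + C" and "u = A * (B + C) * (1 - cos t)"
  have S: "0 < S" using assms by (simp add: S_def)
  have "u \<le> A * (B + C) * 2"
    unfolding u_def using assms cos_ge_minus_one[of t] by (intro mult_left_mono) auto
  also have "\<dots> \<le> S\<^sup>2"
    using sum_squares_ge_zero[of A "B + C"] unfolding S_def by (simp add: power2_eq_square algebra_simps)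
  finally have u: "u / S \<le> S" using S by (simp add: divide_le_eq power2_eq_square)
  have "(cmod (of_real A + of_real B * cis t + of_real C * cis (- t)))\<^sup>2 =
      (A + B * cos t + C * cos t)\<^sup>2 + (B * sin t - C * sin t)\<^sup>2"
    by (simp add: cmod_power2)
  also have "\<dots> = S\<^sup>2 - 2 * u - 4 * B * C * (sin t)\<^sup>2"
  proof -
    have *: "x\<^sup>2 + y\<^sup>2 = 1 \<Longrightarrow>
      (A + B * x + C * x)\<^sup>2 + (B * y - C * y)\<^sup>2 = (A+B+C)\<^sup>2 - 2 * (A * (B + C) * (1 - x)) - 4 * B * C * y\<^sup>2" for x y :: real
      by algebra
    show ?thesis unfolding S_def u_def by (rule *) (rule sin_cos_squared_add2)
  qed
  also have "\<dots> \<le> S\<^sup>2 - 2 * u"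
    using assms by simp
  also have "\<dots> \<le> (S - u / S)\<^sup>2"
    using S by (simp add: power2_diff)
  finally show ?thesis
    using u by (simp add: S_def[symmetric] u_def[symmetric] abs_le_square_iff[symmetric])
qed

section \<open>Concentration and characteristic function of the integer Gaussian\<close>

definition gauss_weight :: "real \<Rightarrow> real \<Rightarrow> int \<Rightarrow> real" where
  "gauss_weight b a k = exp (- (b / 2) * (of_int k - a)\<^sup>2)"

lemma gauss_weight_pos [simp]: "0 < gauss_weight b a k"
  by (simp add: gauss_weight_def)

lemma gauss_weight_nonneg [simp]: "0 \<le> gauss_weight b a k"
  by (simp add: gauss_weight_def)

lemma gauss_weight_summable: "0 < b \<Longrightarrow> gauss_weight b a summable_on UNIV"
  using integer_gaussian_summable[of b a] by (simp add: gauss_weight_def[abs_def])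

lemma infsum_gauss_weight_pos:
  assumes "0 < b"
  shows "0 < infsum (gauss_weight b a) UNIV"
proof -
  have "gauss_weight b a 0 \<le> infsum (gauss_weight b a) UNIV"
    using infsum_mono_neutral[of "gauss_weight b a" "{0}" "gauss_weight b a" UNIV]
      gauss_weight_summable[OF assms] by auto
  then show ?thesis using gauss_weight_pos[of b a 0] by linarith
qed

lemma pmf_integer_gaussian':
  "0 < b \<Longrightarrow> pmf (integer_gaussian a b) k = gauss_weight b a k / infsum (gauss_weight b a) UNIV"
  by (simp add: pmf_integer_gaussian gauss_weight_def[abs_def])

lemma gauss_weight_eq_centre:
  "gauss_weight b c k = gauss_weight b c 0 * exp (- (b / 2) * ((of_int k)\<^sup>2 - 2 * of_int k * c))"
  unfolding gauss_weight_def exp_add[symmetric] by (simp add: power2_eq_square algebra_simps)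

text \<open>
  For a centre in \<open>[-1/2, 1/2]\<close> and large \<open>b\<close> the mass sits on \<open>{-1, 0, 1}\<close>. By the inequality of
  the arithmetic and geometric means, the two neighbours of \<open>0\<close> together weigh least,
  \<open>2 * exp (- b / 2)\<close> relative to \<open>0\<close>, at the centre \<open>0\<close>.
\<close>

lemma gauss_weight_three_sites:
  fixes b c :: real
  defines "r \<equiv> exp (- (b / 2))" and "g \<equiv> gauss_weight b c"
  assumes b: "0 < b" and r: "r \<le> 1 / 1000" and c: "\<bar>c\<bar> \<le> 1 / 2"
  shows "infsum g (- {-1, 0, 1}) \<le> g 0 / 100"
    and "infsum g UNIV = g 0 + g 1 + g (-1) + infsum g (- {-1, 0, 1})"
    and "g 1 + g (-1) \<le> 2 * g 0"
    and "8 / 5 * r * (infsum g UNIV)\<^sup>2 \<le> g 0 * (g 1 + g (-1))"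
proof -
  have r0: "0 < r" by (simp add: r_def)
  have sm: "g summable_on UNIV" unfolding g_def by (rule gauss_weight_summable[OF b])
  have gp: "0 < g k" for k by (simp add: g_def)
  show split: "infsum g UNIV = g 0 + g 1 + g (-1) + infsum g (- {-1, 0, 1})"
  proof -
    have "infsum g ({-1, 0, 1} \<union> - {-1, 0, 1}) = infsum g {-1, 0, 1} + infsum g (- {-1, 0, 1})"
      by (rule infsum_Un_disjoint) (auto intro: summable_on_subset_banach[OF sm])
    then show ?thesis by simp
  qed
  show tail: "infsum g (- {-1, 0, 1}) \<le> g 0 / 100"
  proof -
    \<comment> \<open>For \<open>\<bar>k\<bar> \<ge> 2\<close> and
      \<open>\<bar>c\<bar> \<le> 1 / 2\<close> the exponent satisfies \<open>k\<^sup>2 - 2 * k * c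
      \<ge> k\<^sup>2 - \<bar>k\<bar> \<ge> \<bar>k\<bar>\<close>, so a geometric series dominates
      the tail.\<close>
    have le: "g k \<le> g 0 * r ^ nat \<bar>k\<bar>" if "k \<notin> {-1, 0, 1}" for k
    proof -
      have k2: "2 \<le> \<bar>k\<bar>" using that by auto
      have "of_int k * c \<le> \<bar>of_int k\<bar> * (1 / 2)"
        using mult_left_mono[OF c, of "\<bar>of_int k\<bar>"] by (metis abs_ge_self abs_ge_zero abs_mult order_trans)
      moreover have "2 * \<bar>of_int k :: real\<bar> \<le> (of_int k)\<^sup>2"
      proof -
        have "2 * \<bar>k\<bar> \<le> k\<^sup>2" using mult_right_mono[OF k2, of "\<bar>k\<bar>"] by (simp add: power2_eq_square)
        then show ?thesis by (metis (mono_tags, opaque_lifting) of_int_abs of_int_le_iff of_int_mult of_int_numeral of_int_power)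
      qed
      ultimately have "real (nat \<bar>k\<bar>) \<le> (of_int k)\<^sup>2 - 2 * of_int k * c" by simp
      then have "- (b / 2) * ((of_int k)\<^sup>2 - 2 * of_int k * c) \<le> real (nat \<bar>k\<bar>) * (- (b / 2))"
        using mult_left_mono[of "real (nat \<bar>k\<bar>)" "(of_int k)\<^sup>2 - 2 * of_int k * c" "b / 2"] b by (auto simp: algebra_simps)
      then have "exp (- (b / 2) * ((of_int k)\<^sup>2 - 2 * of_int k * c)) \<le> r ^ nat \<bar>k\<bar>"
        unfolding r_def exp_of_nat_mult[symmetric] by simp
      then show ?thesis
        unfolding g_def by (subst gauss_weight_eq_centre) (simp add: mult_left_mono)
    qed
    have hs: "((\<lambda>k::int. r ^ nat \<bar>k\<bar>) has_sum (1 + r) / (1 - r)) UNIV"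
      by (rule has_sum_power_nat_abs) (use r0 r in auto)
    have "((\<lambda>k::int. r ^ nat \<bar>k\<bar>) has_sum (1 + 2 * r)) {-1, 0, 1}"
      by (rule has_sum_finiteI) auto
    then have "((\<lambda>k::int. r ^ nat \<bar>k\<bar>) has_sum (1 + r) / (1 - r) - (1 + 2 * r)) (UNIV - {-1, 0, 1})"
      by (intro has_sum_Diff hs) auto
    then have hs': "((\<lambda>k::int. g 0 * r ^ nat \<bar>k\<bar>) has_sum g 0 * ((1 + r) / (1 - r) - (1 + 2 * r))) (- {-1, 0, 1})"
      by (intro has_sum_cmult_right) (simp add: Compl_eq_Diff_UNIV)
    have "infsum g (- {-1, 0, 1}) \<le> g 0 * ((1 + r) / (1 - r) - (1 + 2 * r))"
      by (rule has_sum_mono[OF has_sum_infsum hs']) (use le in \<open>auto intro: summable_on_subset_banach[OF sm]\<close>)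
    also have "(1 + r) / (1 - r) - (1 + 2 * r) = 2 * r\<^sup>2 / (1 - r)"
      using r by (simp add: field_simps power2_eq_square)
    also have "2 * r\<^sup>2 / (1 - r) \<le> 1 / 100"
    proof -
      have "r\<^sup>2 \<le> r / 1000" using mult_left_mono[OF r, of r] r0 by (simp add: power2_eq_square)
      then show ?thesis using r by (simp add: divide_le_eq)
    qed
    finally show ?thesis using gp[of 0] by (simp add: mult_left_mono)
  qed
  define x y where "x = exp (- (b / 2) * (1 - 2 * c))" and "y = exp (- (b / 2) * (1 + 2 * c))"
  have g1: "g 1 = g 0 * x" "g (-1) = g 0 * y"
    unfolding g_def x_def y_def by (subst gauss_weight_eq_centre, simp)+
  have xy: "0 < x" "x \<le> 1" "0 < y" "y \<le> 1"
    using b c by (auto simp: x_def y_def intro!: mult_nonneg_nonneg)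
  have "x * y = r\<^sup>2"
    unfolding x_def y_def r_def power2_eq_square exp_add[symmetric] by (simp add: algebra_simps)
  moreover have "4 * (x * y) \<le> (x + y)\<^sup>2"
    using zero_le_power2[of "x - y"] by (simp add: power2_eq_square algebra_simps)
  ultimately have "(2 * r)\<^sup>2 \<le> (x + y)\<^sup>2"
    by (simp add: power_mult_distrib)
  then have s_ge: "2 * r \<le> x + y"
    by (rule power2_le_imp_le) (use xy in auto)
  have sum_eq: "g 1 + g (-1) = g 0 * (x + y)" by (simp add: g1 algebra_simps)
  show "g 1 + g (-1) \<le> 2 * g 0"
    unfolding sum_eq using xy gp[of 0] by (auto simp: mult.commute)
  \<comment> \<open>If the neighbours are light, the bracket squared is at most \<open>5 / 4\<close>
    and \<open>x + y \<ge> 2 * r\<close> decides, whence \<open>8 / 5 = 2 / (5 / 4)\<close>. If they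
    are not, the bracket is still bounded and the smallness of \<open>r\<close> decides.\<close>
  have *: "8 / 5 * r * (1 + (x + y) + 1 / 100)\<^sup>2 \<le> x + y"
  proof (cases "x + y \<le> 1 / 10")
    case True
    then have "(1 + (x + y) + 1 / 100)\<^sup>2 \<le> (111 / 100)\<^sup>2" using xy by (intro power_mono) auto
    then have "8 / 5 * r * (1 + (x + y) + 1 / 100)\<^sup>2 \<le> 8 / 5 * r * (5 / 4)"
      using r0 by (intro mult_left_mono) (auto simp: power2_eq_square)
    then show ?thesis using s_ge by simp
  next
    case False
    have "(1 + (x + y) + 1 / 100)\<^sup>2 \<le> (301 / 100)\<^sup>2" using xy by (intro power_mono) auto
    then have "8 / 5 * r * (1 + (x + y) + 1 / 100)\<^sup>2 \<le> 8 / 5 * (1 / 1000) * (10)"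
      using r0 r by (intro mult_mono) (auto simp: power2_eq_square)
    then show ?thesis using False by simp
  qed
  have "infsum g UNIV \<le> g 0 * (1 + (x + y) + 1 / 100)"
    using tail unfolding split by (simp add: g1 algebra_simps)
  moreover have "0 \<le> infsum g UNIV" by (rule infsum_nonneg) (simp add: g_def)
  ultimately have "(infsum g UNIV)\<^sup>2 \<le> (g 0 * (1 + (x + y) + 1 / 100))\<^sup>2"
    by (rule power_mono)
  then have "8 / 5 * r * (infsum g UNIV)\<^sup>2 \<le> 8 / 5 * r * (g 0 * (1 + (x + y) + 1 / 100))\<^sup>2"
    using r0 by (intro mult_left_mono) auto
  also have "\<dots> = (g 0)\<^sup>2 * (8 / 5 * r * (1 + (x + y) + 1 / 100)\<^sup>2)"
    by (simp only: power_mult_distrib mult_ac)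
  also have "\<dots> \<le> (g 0)\<^sup>2 * (x + y)"
    by (rule mult_left_mono[OF *]) simp
  finally show "8 / 5 * r * (infsum g UNIV)\<^sup>2 \<le> g 0 * (g 1 + g (-1))"
    unfolding sum_eq by (simp add: power2_eq_square mult.assoc)
qed

text \<open>All cancellation is taken from the three central sites; the tail enters with its full
  mass. The constant \<open>16 / 25\<close> is the product of \<open>8 / 5\<close> from
  \<open>gauss_weight_three_sites\<close> and \<open>2 / 5\<close> from
  \<open>one_minus_cos_ge\<close>. The exponential form, from \<open>1 - x \<le> exp (- x)\<close>,
  is what multiplies well over edges.\<close>

lemma gauss_characteristic_le_centred:
  fixes b c t :: real
  defines "r \<equiv> exp (- (b / 2))" and "g \<equiv> gauss_weight b c"
  assumes b: "0 < b" and r: "r \<le> 1 / 1000" and c: "\<bar>c\<bar> \<le> 1 / 2" and t: "\<bar>t\<bar> \<le> 1"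
  shows "cmod (\<Sum>\<^sub>\<infinity>k. of_real (g k) * cis (t * of_int k)) \<le> infsum g UNIV * exp (- (16 / 25 * r * t\<^sup>2))"
proof -
  note three = gauss_weight_three_sites[OF b r[unfolded r_def] c, folded r_def g_def]
  define Z S where "Z = infsum g UNIV" and "S = g 0 + g 1 + g (-1)"
  have Z: "0 < Z" unfolding Z_def g_def by (rule infsum_gauss_weight_pos[OF b])
  have S: "0 < S" by (simp add: S_def g_def add_pos_pos)
  have sm: "g summable_on UNIV" unfolding g_def by (rule gauss_weight_summable[OF b])
  have gn: "0 \<le> g k" for k by (simp add: g_def)
  have gsm: "g summable_on A" for A by (rule summable_on_subset_banach[OF sm]) auto
  have csm: "(\<lambda>k. of_real (g k) * cis (t * of_int k)) summable_on A" for A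
    by (rule abs_summable_summable) (use gsm[of A] gn in \<open>simp add: norm_mult\<close>)
  define T where "T = infsum g (- {-1, 0, 1})"
  have T: "0 \<le> T" unfolding T_def by (rule infsum_nonneg) (simp add: gn)
  have ZST: "Z = S + T" using three(2) by (simp add: Z_def S_def T_def)
  have "(\<Sum>\<^sub>\<infinity>k. of_real (g k) * cis (t * of_int k)) =
      infsum (\<lambda>k. of_real (g k) * cis (t * of_int k)) ({-1, 0, 1} \<union> - {-1, 0, 1})"
    by simp
  also have "\<dots> = infsum (\<lambda>k. of_real (g k) * cis (t * of_int k)) {-1, 0, 1}
      + infsum (\<lambda>k. of_real (g k) * cis (t * of_int k)) (- {-1, 0, 1})"
    by (rule infsum_Un_disjoint) (auto intro: csm)
  also have "cmod \<dots> \<le> cmod (infsum (\<lambda>k. of_real (g k) * cis (t * of_int k)) {-1, 0, 1}) + T"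
  proof -
    have "cmod (infsum (\<lambda>k. of_real (g k) * cis (t * of_int k)) (- {-1, 0, 1})) \<le> T"
      unfolding T_def by (rule norm_infsum_le[OF has_sum_infsum has_sum_infsum])
        (use csm gsm gn in \<open>auto simp: norm_mult\<close>)
    then show ?thesis by (rule norm_triangle_le[OF add_left_mono])
  qed
  also have "infsum (\<lambda>k. of_real (g k) * cis (t * of_int k)) {-1, 0, 1} =
      of_real (g 0) + of_real (g 1) * cis t + of_real (g (-1)) * cis (- t)"
    by simp
  also have "cmod \<dots> \<le> S - Z * (16 / 25 * r * t\<^sup>2)"
  proof -
    have three_le: "cmod (of_real (g 0) + of_real (g 1) * cis t + of_real (g (-1)) * cis (- t))
        \<le> S - g 0 * (g 1 + g (-1)) * (1 - cos t) / S"
      using cmod_three_point_le[of "g 0" "g 1" "g (-1)" t] by (simp add: S_def g_def)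
    have "Z * (16 / 25 * r * t\<^sup>2) * S \<le> Z * (16 / 25 * r * t\<^sup>2) * Z"
      using Z T ZST by (intro mult_left_mono) (auto simp: r_def)
    also have "\<dots> = (8 / 5 * r * Z\<^sup>2) * (2 / 5 * t\<^sup>2)"
      by (simp add: power2_eq_square)
    also have "\<dots> \<le> (g 0 * (g 1 + g (-1))) * (1 - cos t)"
      by (rule mult_mono) (use three(4) one_minus_cos_ge[OF t] gn in \<open>auto simp: Z_def\<close>)
    finally have "Z * (16 / 25 * r * t\<^sup>2) \<le> g 0 * (g 1 + g (-1)) * (1 - cos t) / S"
      using S by (simp add: pos_le_divide_eq)
    with three_le show ?thesis by linarith
  qed
  also have "S - Z * (16 / 25 * r * t\<^sup>2) + T = Z * (1 - 16 / 25 * r * t\<^sup>2)"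
    by (simp add: ZST algebra_simps)
  also have "\<dots> \<le> Z * exp (- (16 / 25 * r * t\<^sup>2))"
    using Z exp_ge_add_one_self[of "- (16 / 25 * r * t\<^sup>2)"] by (intro mult_left_mono) auto
  finally show ?thesis by (simp add: Z_def)
qed

text \<open>Translating by the integer nearest to the centre only multiplies the sum by a
  phase.\<close>

lemma gauss_characteristic_le:
  fixes a b t :: real
  defines "r \<equiv> exp (- (b / 2))"
  assumes b: "0 < b" and r: "r \<le> 1 / 1000" and t: "\<bar>t\<bar> \<le> 1"
  shows "cmod (\<Sum>\<^sub>\<infinity>k. of_real (gauss_weight b a k) * cis (t * of_int k))
    \<le> infsum (gauss_weight b a) UNIV * exp (- (16 / 25 * r * t\<^sup>2))"
proof -
  define m c where "m = round a" and "c = a - of_int m"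
  have c: "\<bar>c\<bar> \<le> 1 / 2"
    using of_int_round_abs_le[of a] by (simp add: c_def m_def abs_minus_commute)
  have shift: "gauss_weight b a (k + m) = gauss_weight b c k" for k
    by (simp add: gauss_weight_def c_def algebra_simps)
  have bij: "bij_betw (\<lambda>k. k + m) UNIV (UNIV :: int set)"
    by (rule bij_betwI[of _ _ _ "\<lambda>k. k - m"]) auto
  have "(\<Sum>\<^sub>\<infinity>k. of_real (gauss_weight b a k) * cis (t * of_int k)) =
      (\<Sum>\<^sub>\<infinity>k. of_real (gauss_weight b c k) * cis (t * of_int (k + m)))"
    using infsum_reindex_bij_betw[OF bij, of "\<lambda>k. of_real (gauss_weight b a k) * cis (t * of_int k)"]
    by (simp add: shift)
  also have "\<dots> = (\<Sum>\<^sub>\<infinity>k. cis (t * of_int m) * (of_real (gauss_weight b c k) * cis (t * of_int k)))"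
    by (intro infsum_cong) (simp add: algebra_simps cis_mult)
  also have "\<dots> = cis (t * of_int m) * (\<Sum>\<^sub>\<infinity>k. of_real (gauss_weight b c k) * cis (t * of_int k))"
    by (rule infsum_cmult_right')
  finally have "cmod (\<Sum>\<^sub>\<infinity>k. of_real (gauss_weight b a k) * cis (t * of_int k)) =
      cmod (\<Sum>\<^sub>\<infinity>k. of_real (gauss_weight b c k) * cis (t * of_int k))"
    by (simp add: norm_mult)
  moreover have "infsum (gauss_weight b a) UNIV = infsum (gauss_weight b c) UNIV"
    using infsum_reindex_bij_betw[OF bij, of "gauss_weight b a"] by (simp add: shift)
  ultimately show ?thesis
    using gauss_characteristic_le_centred[OF b r[unfolded r_def] c t] by (simp add: r_def)
qed

section \<open>Second moments and the minimal variance\<close>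

lemma gauss_weight_square_summable:
  assumes b: "0 < b"
  shows "(\<lambda>k. (of_int k)\<^sup>2 * gauss_weight b a k) summable_on UNIV"
proof -
  have "(\<lambda>k. 8 / b * gauss_weight (b / 2) a k + 2 * a\<^sup>2 * gauss_weight b a k) summable_on UNIV"
    by (intro summable_on_add summable_on_cmult_right gauss_weight_summable) (use b in auto)
  then show ?thesis
  proof (rule summable_on_comparison_test)
    fix k :: int
    define d where "d = (of_int k - a)\<^sup>2"
    \<comment> \<open>Half of the Gaussian decay is spent on absorbing the quadratic factor.\<close>
    have "b / 4 * d \<le> exp (b / 4 * d)"
      using exp_ge_add_one_self[of "b / 4 * d"] by linarith
    then have "d \<le> 4 / b * exp (b / 4 * d)"
      using b by (simp add: field_simps)
    then have "2 * d * exp (- (b / 2) * d) \<le> 2 * (4 / b * exp (b / 4 * d)) * exp (- (b / 2) * d)"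
      by (intro mult_right_mono mult_left_mono) auto
    also have "\<dots> = 8 / b * exp (- (b / 2 / 2) * d)"
      by (simp add: exp_add[symmetric] mult.assoc)
    finally have *: "2 * d * gauss_weight b a k \<le> 8 / b * gauss_weight (b / 2) a k"
      by (simp add: gauss_weight_def d_def)
    have "(of_int k)\<^sup>2 \<le> 2 * d + 2 * a\<^sup>2"
      using zero_le_power2[of "of_int k - 2 * a"] by (simp add: d_def power2_eq_square algebra_simps)
    then have "(of_int k)\<^sup>2 * gauss_weight b a k \<le> (2 * d + 2 * a\<^sup>2) * gauss_weight b a k"
      by (intro mult_right_mono) auto
    then show "(of_int k)\<^sup>2 * gauss_weight b a k \<le> 8 / b * gauss_weight (b / 2) a k + 2 * a\<^sup>2 * gauss_weight b a k"
      using * by (simp add: algebra_simps)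
  qed simp
qed

lemma expectation_pmf_eq_infsum:
  fixes f :: "'a \<Rightarrow> real"
  assumes "(\<lambda>k. f k * pmf p k) summable_on UNIV"
  shows "integrable (measure_pmf p) f"
    and "measure_pmf.expectation p f = (\<Sum>\<^sub>\<infinity>k. f k * pmf p k)"
proof -
  have abs: "Infinite_Set_Sum.abs_summable_on (\<lambda>k. f k * pmf p k) UNIV"
    unfolding abs_summable_equivalent[symmetric] using assms
    by (rule iffD1[OF summable_on_iff_abs_summable_on_real])
  then show "integrable (measure_pmf p) f"
    unfolding measure_pmf_eq_density
    by (subst integrable_density) (auto simp: abs_summable_on_def mult.commute)
  have "measure_pmf.expectation p f = infsetsum (\<lambda>k. f k * pmf p k) UNIV"
    unfolding measure_pmf_eq_density
    by (subst integral_density) (auto simp: infsetsum_def mult.commute)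
  then show "measure_pmf.expectation p f = (\<Sum>\<^sub>\<infinity>k. f k * pmf p k)"
    using infsetsum_infsum[OF abs] by simp
qed

lemma integer_gaussian_square_integrable:
  assumes b: "0 < b"
  shows "integrable (integer_gaussian a b) (\<lambda>k. (real_of_int k)\<^sup>2)"
    and "integrable (integer_gaussian a b) real_of_int"
    and "measure_pmf.expectation (integer_gaussian a b) (\<lambda>k. (real_of_int k)\<^sup>2) =
      (\<Sum>\<^sub>\<infinity>k. (of_int k)\<^sup>2 * gauss_weight b a k) / infsum (gauss_weight b a) UNIV"
proof -
  have eq: "(\<lambda>k. (real_of_int k)\<^sup>2 * pmf (integer_gaussian a b) k) =
      (\<lambda>k. (of_int k)\<^sup>2 * gauss_weight b a k * inverse (infsum (gauss_weight b a) UNIV))"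
    by (simp add: pmf_integer_gaussian'[OF b] divide_inverse mult.assoc)
  have sm: "(\<lambda>k. (real_of_int k)\<^sup>2 * pmf (integer_gaussian a b) k) summable_on UNIV"
    unfolding eq by (intro summable_on_cmult_left gauss_weight_square_summable b)
  show sq: "integrable (integer_gaussian a b) (\<lambda>k. (real_of_int k)\<^sup>2)"
    by (rule expectation_pmf_eq_infsum[OF sm])
  then show "integrable (integer_gaussian a b) real_of_int"
    by (rule measure_pmf.square_integrable_imp_integrable[rotated]) simp
  show "measure_pmf.expectation (integer_gaussian a b) (\<lambda>k. (real_of_int k)\<^sup>2) =
      (\<Sum>\<^sub>\<infinity>k. (of_int k)\<^sup>2 * gauss_weight b a k) / infsum (gauss_weight b a) UNIV"
    unfolding expectation_pmf_eq_infsum(2)[OF sm] eq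
    by (simp add: infsum_cmult_left' divide_inverse)
qed

lemma Var_IG_nonneg: "0 \<le> Var_IG a b"
  unfolding Var_IG_def by (rule integral_nonneg_AE) simp

text \<open>The centre \<open>0\<close> serves as competitor in the infimum defining
  \<open>min_Var_IG\<close>. Since \<open>k\<^sup>2 \<le> 4 ^ (\<bar>k\<bar> - 1)\<close> for
  nonzero \<open>k\<close>, the second moment is dominated by a geometric series with sum
  \<open>2 * r / (1 - 4 * r)\<close>, and \<open>2 / (1 - 4 / 1000)\<close> is below
  \<open>201 / 100\<close>.\<close>

lemma Var_IG_zero_le:
  assumes b: "0 < b" and r: "exp (- (b / 2)) \<le> 1 / 1000"
  shows "Var_IG 0 b \<le> 201 / 100 * exp (- (b / 2))"
proof -
  define r g where "r = exp (- (b / 2))" and "g = gauss_weight b 0"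
  have r0: "0 < r" and r1: "r \<le> 1 / 1000" using r by (auto simp: r_def)
  note I = integer_gaussian_square_integrable[OF b, of 0]
  have "g 0 \<le> infsum g UNIV"
    using infsum_mono_neutral[of g "{0}" g UNIV] gauss_weight_summable[OF b] by (auto simp: g_def)
  then have Z: "1 \<le> infsum g UNIV" by (simp add: g_def gauss_weight_def)
  have le: "(of_int k)\<^sup>2 * g k \<le> 1 / 4 * (4 * r) ^ nat \<bar>k\<bar>" if "k \<noteq> 0" for k :: int
  proof -
    have "0 < nat \<bar>k\<bar>" using that by simp
    then obtain n where n: "nat \<bar>k\<bar> = Suc n" using gr0_implies_Suc by blast
    have k2: "(of_int k :: real)\<^sup>2 = (real (Suc n))\<^sup>2"
      using n by (metis of_int_abs of_nat_nat abs_ge_zero of_int_of_nat_eq power2_abs)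
    have "(Suc n)\<^sup>2 \<le> 4 ^ n"
    proof (induction n)
      case (Suc n)
      have "(Suc (Suc n))\<^sup>2 \<le> 4 * (Suc n)\<^sup>2" by (simp add: power2_eq_square)
      then show ?case using Suc by simp
    qed simp
    then have "real ((Suc n)\<^sup>2) \<le> real (4 ^ n)" by (simp only: of_nat_le_iff)
    then have 1: "(of_int k :: real)\<^sup>2 \<le> 1 / 4 * 4 ^ Suc n" by (simp add: k2)
    have "- (b / 2) * (real (Suc n))\<^sup>2 \<le> real (Suc n) * (- (b / 2))"
      using b by (simp add: power2_eq_square algebra_simps)
    then have "g k \<le> exp (real (Suc n) * (- (b / 2)))"
      unfolding g_def gauss_weight_def by (simp add: k2)
    then have "g k \<le> r ^ Suc n"
      unfolding r_def exp_of_nat_mult .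
    with 1 have "(of_int k)\<^sup>2 * g k \<le> (1 / 4 * 4 ^ Suc n) * r ^ Suc n"
      by (rule mult_mono) (auto simp: g_def)
    then show ?thesis by (simp add: n power_mult_distrib mult_ac)
  qed
  have hs: "((\<lambda>k::int. (4 * r) ^ nat \<bar>k\<bar>) has_sum (1 + 4 * r) / (1 - 4 * r)) UNIV"
    by (rule has_sum_power_nat_abs) (use r0 r1 in auto)
  have "((\<lambda>k::int. (4 * r) ^ nat \<bar>k\<bar>) has_sum 1) {0}"
    by (rule has_sum_finiteI) auto
  then have "((\<lambda>k::int. (4 * r) ^ nat \<bar>k\<bar>) has_sum (1 + 4 * r) / (1 - 4 * r) - 1) (UNIV - {0})"
    by (intro has_sum_Diff hs) auto
  then have hs': "((\<lambda>k::int. 1 / 4 * (4 * r) ^ nat \<bar>k\<bar>) has_sum 1 / 4 * ((1 + 4 * r) / (1 - 4 * r) - 1)) (UNIV - {0})"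
    by (rule has_sum_cmult_right)
  have "(\<Sum>\<^sub>\<infinity>k. (of_int k)\<^sup>2 * g k) = (\<Sum>\<^sub>\<infinity>k\<in>UNIV - {0}. (of_int k)\<^sup>2 * g k)"
    by (rule infsum_cong_neutral) auto
  also have "\<dots> \<le> 1 / 4 * ((1 + 4 * r) / (1 - 4 * r) - 1)"
  proof (rule has_sum_mono[OF has_sum_infsum hs'])
    show "(\<lambda>k. (of_int k)\<^sup>2 * g k) summable_on UNIV - {0}"
      unfolding g_def by (rule summable_on_subset_banach[OF gauss_weight_square_summable[OF b]]) auto
  qed (use le in auto)
  also have "\<dots> = 2 * r / (1 - 4 * r)"
    using r1 by (simp add: field_simps)
  also have "\<dots> \<le> 201 / 100 * r"
  proof -
    have "2 * r \<le> r * (201 / 100 * (1 - 4 * r))"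
      using r0 r1 by (subst mult.commute, intro mult_left_mono) auto
    then show ?thesis using r1 by (simp add: divide_le_eq mult_ac)
  qed
  finally have sum_le: "(\<Sum>\<^sub>\<infinity>k. (of_int k)\<^sup>2 * g k) \<le> 201 / 100 * r" .
  have "Var_IG 0 b \<le> measure_pmf.expectation (integer_gaussian 0 b) (\<lambda>k. (real_of_int k)\<^sup>2)"
    unfolding Var_IG_def measure_pmf.variance_eq[OF I(2,1)] by simp
  also have "\<dots> = (\<Sum>\<^sub>\<infinity>k. (of_int k)\<^sup>2 * g k) / infsum g UNIV"
    unfolding g_def by (rule I(3))
  also have "\<dots> \<le> (\<Sum>\<^sub>\<infinity>k. (of_int k)\<^sup>2 * g k)"
  proof -
    have "0 \<le> (\<Sum>\<^sub>\<infinity>k. (of_int k)\<^sup>2 * g k)" by (rule infsum_nonneg) (simp add: g_def)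
    then show ?thesis using Z by (simp add: divide_le_eq mult_le_cancel_left1)
  qed
  finally show ?thesis using sum_le by (simp add: r_def)
qed

text \<open>The atoms at \<open>0\<close> and \<open>1\<close> alone give variance at least
  \<open>pmf p 0 * pmf p 1\<close>. For centres in \<open>[0, 1/2]\<close> the weight of
  \<open>1\<close> relative to \<open>0\<close> is at least \<open>exp (- (b / 2))\<close>, and the
  total mass is at most \<open>301 / 100\<close> times the weight of \<open>0\<close>, whose square
  stays below \<open>10\<close>.\<close>

lemma Var_IG_ge:
  assumes b: "0 < b" and r: "exp (- (b / 2)) \<le> 1 / 1000" and a: "0 \<le> a" "a \<le> 1 / 2"
  shows "1 / 10 * exp (- (b / 2)) \<le> Var_IG a b"
proof -
  define g p Z where "g = gauss_weight b a" and "p = integer_gaussian a b" and "Z = infsum g UNIV"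
  have a': "\<bar>a\<bar> \<le> 1 / 2" using a by simp
  note three = gauss_weight_three_sites[OF b r a', folded g_def, folded Z_def]
  note I = integer_gaussian_square_integrable[OF b, of a, folded p_def]
  have Z: "0 < Z" unfolding Z_def g_def by (rule infsum_gauss_weight_pos[OF b])
  have gp: "0 < g k" for k by (simp add: g_def)
  have pk: "pmf p k = g k / Z" for k by (simp add: p_def g_def Z_def pmf_integer_gaussian'[OF b])
  define m where "m = measure_pmf.expectation p real_of_int"
  define h where "h = (\<lambda>k::int. if k = 0 then m\<^sup>2 else if k = 1 then (1 - m)\<^sup>2 else 0)"
  have int: "integrable p (\<lambda>k. (real_of_int k - m)\<^sup>2)"
    using I(1,2) by (auto simp: power2_diff intro!: Bochner_Integration.integrable_add
        Bochner_Integration.integrable_diff)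
  have "measure_pmf.expectation p h = (\<Sum>k\<in>{0, 1}. h k * pmf p k)"
    by (rule integral_measure_pmf_real) (auto simp: h_def split: if_splits)
  also have "\<dots> = m\<^sup>2 * pmf p 0 + (1 - m)\<^sup>2 * pmf p 1"
    by (simp add: h_def)
  finally have Eh: "measure_pmf.expectation p h = m\<^sup>2 * pmf p 0 + (1 - m)\<^sup>2 * pmf p 1" .
  have "measure_pmf.expectation p h \<le> Var_IG a b"
    unfolding Var_IG_def p_def[symmetric] m_def[symmetric]
    by (rule integral_mono_AE'[OF int]) (auto simp: h_def power2_commute)
  moreover have "pmf p 0 * pmf p 1 \<le> m\<^sup>2 * pmf p 0 + (1 - m)\<^sup>2 * pmf p 1"
  proof -
    have "u * v \<le> m\<^sup>2 * u + (1 - m)\<^sup>2 * v" if "0 \<le> u" "0 \<le> v" "u + v \<le> 1" for u v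
    proof -
      \<comment> \<open>This square is exactly the difference of the two sides in the next
        inequality.\<close>
      have "0 \<le> (m * u - (1 - m) * v)\<^sup>2" by simp
      then have "u * v \<le> (u + v) * (m\<^sup>2 * u + (1 - m)\<^sup>2 * v)"
        by (simp add: power2_eq_square algebra_simps)
      also have "\<dots> \<le> 1 * (m\<^sup>2 * u + (1 - m)\<^sup>2 * v)"
        using that by (intro mult_right_mono) auto
      finally show ?thesis by simp
    qed
    moreover have "pmf p 0 + pmf p 1 \<le> 1"
    proof -
      have "pmf p 0 + pmf p 1 = measure p {0, 1}"
        by (subst measure_measure_pmf_finite) auto
      then show ?thesis by simp
    qed
    ultimately show ?thesis by simp
  qed
  moreover have "1 / 10 * exp (- (b / 2)) \<le> pmf p 0 * pmf p 1"
  proof -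
    have "g 1 = g 0 * exp (- (b / 2) * (1 - 2 * a))"
      unfolding g_def by (subst gauss_weight_eq_centre) simp
    moreover have "- (b / 2) \<le> - (b / 2) * (1 - 2 * a)"
      using b a by (simp add: mult_left_le)
    ultimately have g1: "g 0 * exp (- (b / 2)) \<le> g 1"
      using gp[of 0] by simp
    have "Z \<le> g 0 * (301 / 100)" using three(1,2,3) by simp
    then have "Z\<^sup>2 \<le> (g 0 * (301 / 100))\<^sup>2" using Z by (intro power_mono) auto
    also have "\<dots> \<le> 10 * (g 0)\<^sup>2" by (simp add: power_mult_distrib power2_eq_square)
    finally have "1 / 10 * exp (- (b / 2)) * Z\<^sup>2 \<le> exp (- (b / 2)) * (g 0)\<^sup>2"
      by simp
    also have "\<dots> \<le> g 0 * g 1"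
      using mult_left_mono[OF g1, of "g 0"] gp[of 0] by (simp add: power2_eq_square mult_ac)
    finally show ?thesis
      using Z by (simp add: pk field_simps power2_eq_square)
  qed
  ultimately show ?thesis unfolding Eh by linarith
qed

definition min_Var_IG :: "real \<Rightarrow> real" where
  "min_Var_IG b = (INF a\<in>{0..1/2}. Var_IG a b)"

lemma M_error_eq: "M_error \<beta> = (2 * pi)\<^sup>2 * \<beta> * min_Var_IG ((2 * pi)\<^sup>2 * \<beta>)"
  by (simp add: M_error_def min_Var_IG_def)

lemma min_Var_IG_bounds:
  assumes b: "0 < b" and r: "exp (- (b / 2)) \<le> 1 / 1000"
  shows "1 / 10 * exp (- (b / 2)) \<le> min_Var_IG b"
    and "min_Var_IG b \<le> 201 / 100 * exp (- (b / 2))"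
proof -
  show "1 / 10 * exp (- (b / 2)) \<le> min_Var_IG b"
    unfolding min_Var_IG_def by (rule cINF_greatest) (use Var_IG_ge[OF b r] in auto)
  have "bdd_below ((\<lambda>a. Var_IG a b) ` {0..1/2})"
    by (rule bdd_belowI2[of _ 0]) (rule Var_IG_nonneg)
  then have "min_Var_IG b \<le> Var_IG 0 b"
    unfolding min_Var_IG_def by (rule cINF_lower) simp
  then show "min_Var_IG b \<le> 201 / 100 * exp (- (b / 2))"
    using Var_IG_zero_le[OF b r] by linarith
qed

section \<open>Contour shift\<close>

definition complex_villain_weight :: "real \<Rightarrow> complex \<Rightarrow> complex" where
  "complex_villain_weight \<beta> z =
     (\<Sum>\<^sub>\<infinity>k\<in>(UNIV :: int set). exp (- (of_real (\<beta> / 2) * (z + of_real (2 * pi * of_int k))\<^sup>2)))"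

lemma cmod_villain_term:
  "cmod (exp (- (of_real (\<beta> / 2) * (z + of_real (2 * pi * of_int k))\<^sup>2))) =
    exp (- (\<beta> / 2) * ((Re z + 2 * pi * of_int k)\<^sup>2 - (Im z)\<^sup>2))"
  by (simp add: Re_power2)

text \<open>Majorant for the Weierstrass test. Half of the decay in \<open>k\<close> is given up, by
  \<open>w\<^sup>2 \<le> 2 * (Re z + w)\<^sup>2 + 2 * (Re z)\<^sup>2\<close>, in exchange for
  uniformity on a disc.\<close>

lemma cmod_villain_term_le:
  assumes \<beta>: "0 \<le> \<beta>" and z: "cmod z \<le> R"
  shows "cmod (exp (- (of_real (\<beta> / 2) * (z + of_real (2 * pi * of_int k))\<^sup>2))) \<le>
    exp (\<beta> * R\<^sup>2) * gauss_weight ((2 * pi)\<^sup>2 * \<beta> / 2) 0 k"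
proof -
  define w where "w = 2 * pi * real_of_int k"
  have "\<bar>Re z\<bar> \<le> R" "\<bar>Im z\<bar> \<le> R"
    using z abs_Re_le_cmod[of z] abs_Im_le_cmod[of z] by linarith+
  then have R: "(Re z)\<^sup>2 \<le> R\<^sup>2" "(Im z)\<^sup>2 \<le> R\<^sup>2"
    by (simp_all add: abs_le_square_iff[symmetric])
  have "w\<^sup>2 \<le> 2 * (Re z + w)\<^sup>2 + 2 * (Re z)\<^sup>2"
    using zero_le_power2[of "2 * Re z + w"] by (simp add: power2_eq_square algebra_simps)
  then have "w\<^sup>2 / 2 - 2 * R\<^sup>2 \<le> (Re z + w)\<^sup>2 - (Im z)\<^sup>2"
    using R by linarith
  then have "\<beta> / 2 * (w\<^sup>2 / 2 - 2 * R\<^sup>2) \<le> \<beta> / 2 * ((Re z + w)\<^sup>2 - (Im z)\<^sup>2)"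
    using \<beta> by (intro mult_left_mono) auto
  then have "exp (- (\<beta> / 2) * ((Re z + w)\<^sup>2 - (Im z)\<^sup>2)) \<le> exp (\<beta> * R\<^sup>2 - \<beta> / 4 * w\<^sup>2)"
    by (simp add: algebra_simps)
  also have "\<dots> = exp (\<beta> * R\<^sup>2) * gauss_weight ((2 * pi)\<^sup>2 * \<beta> / 2) 0 k"
    by (simp add: gauss_weight_def exp_add[symmetric] w_def power_mult_distrib)
  finally show ?thesis
    by (simp only: cmod_villain_term w_def)
qed

lemma complex_villain_weight_uniform_limit:
  assumes "0 < \<beta>"
  shows "uniform_limit (cball 0 R) (\<lambda>X z. \<Sum>k\<in>X. exp (- (of_real (\<beta> / 2) * (z + of_real (2 * pi * of_int k))\<^sup>2)))
    (complex_villain_weight \<beta>) (finite_subsets_at_top (UNIV :: int set))"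
  unfolding complex_villain_weight_def[abs_def]
proof (rule Weierstrass_m_test_general)
  show "(\<lambda>k. exp (\<beta> * R\<^sup>2) * gauss_weight ((2 * pi)\<^sup>2 * \<beta> / 2) 0 k) summable_on (UNIV :: int set)"
    by (rule summable_on_cmult_right[OF gauss_weight_summable]) (use assms in simp)
qed (use cmod_villain_term_le[of \<beta> _ R] assms in auto)

lemma complex_villain_weight_holomorphic:
  assumes "0 < \<beta>"
  shows "complex_villain_weight \<beta> holomorphic_on UNIV"
proof -
  have "complex_villain_weight \<beta> field_differentiable at z" for z
  proof -
    have "complex_villain_weight \<beta> holomorphic_on ball 0 (cmod z + 1)"
    proof (rule holomorphic_uniform_limit[OF _ complex_villain_weight_uniform_limit[OF assms]])
      have hol: "(\<lambda>z. \<Sum>k\<in>X. exp (- (of_real (\<beta> / 2) * (z + of_real (2 * pi * of_int k))\<^sup>2))) holomorphic_on A"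
        for X :: "int set" and A
        by (intro holomorphic_intros)
      have cont: "continuous_on A (\<lambda>z::complex. \<Sum>k\<in>X. exp (- (of_real (\<beta> / 2) * (z + of_real (2 * pi * of_int k))\<^sup>2)))"
        for X :: "int set" and A
        by (rule holomorphic_on_imp_continuous_on[OF hol])
      show "\<forall>\<^sub>F X in finite_subsets_at_top (UNIV :: int set).
          continuous_on (cball 0 (cmod z + 1))
            (\<lambda>z::complex. \<Sum>k\<in>X. exp (- (of_real (\<beta> / 2) * (z + of_real (2 * pi * of_int k))\<^sup>2))) \<and>
          (\<lambda>z. \<Sum>k\<in>X. exp (- (of_real (\<beta> / 2) * (z + of_real (2 * pi * of_int k))\<^sup>2)))
            holomorphic_on ball 0 (cmod z + 1)"
        by (rule always_eventually) (simp only: hol cont simp_thms)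
    qed simp_all
    then show ?thesis
      by (rule holomorphic_on_imp_differentiable_at) auto
  qed
  then show ?thesis
    unfolding holomorphic_on_def using field_differentiable_at_within by blast
qed

lemma complex_villain_weight_periodic: "complex_villain_weight \<beta> (z + of_real (2 * pi)) = complex_villain_weight \<beta> z"
proof -
  have "bij_betw (\<lambda>k. k + 1) UNIV (UNIV :: int set)"
    by (rule bij_betwI[of _ _ _ "\<lambda>k. k - 1"]) auto
  then show ?thesis
    unfolding complex_villain_weight_def
    by (subst infsum_reindex_bij_betw[symmetric, where A = UNIV and B = UNIV and g = "\<lambda>k. k + 1"])
      (simp_all add: algebra_simps)
qed

lemma gauss_weight_angle:
  "gauss_weight ((2 * pi)\<^sup>2 * \<beta>) (- (t / (2 * pi))) k = exp (- (\<beta> / 2) * (t + 2 * pi * of_int k)\<^sup>2)"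
proof -
  have "t + 2 * pi * of_int k = 2 * pi * (of_int k - - (t / (2 * pi)))"
    by (simp add: field_simps)
  then show ?thesis
    unfolding gauss_weight_def by (simp only: power_mult_distrib) (simp add: mult_ac)
qed

text \<open>Completing the square in the complex shift leaves the characteristic function of an integer Gaussian.\<close>

lemma complex_villain_weight_shift:
  "complex_villain_weight \<beta> (Complex t s) = of_real (exp (\<beta> / 2 * s\<^sup>2)) * cis (- (\<beta> * s * t)) *
    (\<Sum>\<^sub>\<infinity>k. of_real (gauss_weight ((2 * pi)\<^sup>2 * \<beta>) (- (t / (2 * pi))) k) * cis (- (2 * pi * \<beta> * s) * of_int k))"
proof -
  have eq: "exp (- (of_real (\<beta> / 2) * (Complex t s + of_real (2 * pi * of_int k))\<^sup>2)) =
      of_real (exp (\<beta> / 2 * s\<^sup>2)) * cis (- (\<beta> * s * t)) *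
        (of_real (gauss_weight ((2 * pi)\<^sup>2 * \<beta>) (- (t / (2 * pi))) k) * cis (- (2 * pi * \<beta> * s) * of_int k))"
    (is "?l = ?r") for k :: int
  proof -
    define u where "u = t + 2 * pi * of_int k"
    have gw: "gauss_weight ((2 * pi)\<^sup>2 * \<beta>) (- (t / (2 * pi))) k = exp (- (\<beta> / 2) * u\<^sup>2)"
      unfolding gauss_weight_angle u_def ..
    have "- (of_real (\<beta> / 2) * (Complex t s + of_real (2 * pi * of_int k))\<^sup>2) =
        of_real (\<beta> / 2 * s\<^sup>2 - \<beta> / 2 * u\<^sup>2) + \<i> * of_real (- (\<beta> * s * u))"
      by (simp add: complex_eq_iff u_def power2_eq_square Re_power2 Im_power2 field_simps)
    then have "?l = of_real (exp (\<beta> / 2 * s\<^sup>2 - \<beta> / 2 * u\<^sup>2)) * cis (- (\<beta> * s * u))"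
      by (simp only: exp_add exp_of_real cis_conv_exp)
    also have "cis (- (\<beta> * s * u)) = cis (- (\<beta> * s * t)) * cis (- (2 * pi * \<beta> * s) * of_int k)"
      by (simp add: cis_mult u_def algebra_simps)
    also have "exp (\<beta> / 2 * s\<^sup>2 - \<beta> / 2 * u\<^sup>2) = exp (\<beta> / 2 * s\<^sup>2) * exp (- (\<beta> / 2) * u\<^sup>2)"
      by (simp add: exp_add[symmetric])
    finally show ?thesis
      unfolding gw by (simp add: mult_ac)
  qed
  show ?thesis
    unfolding complex_villain_weight_def eq by (rule infsum_cmult_right')
qed

text \<open>The weight is a partition function of the integer Gaussian; dividing by it turns the sum
  in \<open>complex_villain_weight_shift\<close> into a characteristic function.\<close>

lemma villain_weight_eq_infsum:
  "villain_weight \<beta> t = infsum (gauss_weight ((2 * pi)\<^sup>2 * \<beta>) (- (t / (2 * pi)))) UNIV"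
  unfolding villain_weight_def gauss_weight_angle[symmetric] ..

lemma villain_weight_pos: "0 < \<beta> \<Longrightarrow> 0 < villain_weight \<beta> t"
  unfolding villain_weight_eq_infsum by (rule infsum_gauss_weight_pos) simp

lemma complex_villain_weight_of_real:
  assumes "0 < \<beta>"
  shows "complex_villain_weight \<beta> (of_real t) = of_real (villain_weight \<beta> t)"
proof -
  have "((\<lambda>k. complex_of_real (gauss_weight ((2 * pi)\<^sup>2 * \<beta>) (- (t / (2 * pi))) k)) has_sum
      of_real (villain_weight \<beta> t)) UNIV"
    unfolding villain_weight_eq_infsum
    by (intro has_sum_of_real has_sum_infsum gauss_weight_summable) (use assms in simp)
  moreover have "complex_of_real t = Complex t 0" by (rule complex_of_real_def)
  ultimately show ?thesis
    by (simp only: complex_villain_weight_shift) (simp add: infsumI)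
qed

text \<open>The trivial bound by \<open>1\<close> on the characteristic function. It holds for
  slopes of any size and supplies the boundedness needed during the contour shift.\<close>

lemma cmod_complex_villain_weight_le:
  assumes \<beta>: "0 < \<beta>"
  shows "cmod (complex_villain_weight \<beta> (Complex t s)) \<le> exp (\<beta> / 2 * s\<^sup>2) * villain_weight \<beta> t"
proof -
  have sm: "gauss_weight ((2 * pi)\<^sup>2 * \<beta>) a summable_on UNIV" for a
    by (rule gauss_weight_summable) (use \<beta> in simp)
  moreover have "(\<lambda>k. of_real (gauss_weight ((2 * pi)\<^sup>2 * \<beta>) a k) * cis (- (2 * pi * \<beta> * s) * of_int k))
      summable_on UNIV" for a
    by (rule abs_summable_summable) (use sm[of a] in \<open>simp add: norm_mult\<close>)
  ultimately have "cmod (\<Sum>\<^sub>\<infinity>k. of_real (gauss_weight ((2 * pi)\<^sup>2 * \<beta>) (- (t / (2 * pi))) k) *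
      cis (- (2 * pi * \<beta> * s) * of_int k)) \<le> villain_weight \<beta> t"
    unfolding villain_weight_eq_infsum
    by (intro norm_infsum_le[OF has_sum_infsum has_sum_infsum]) (auto simp: norm_mult)
  then show ?thesis
    unfolding complex_villain_weight_shift by (simp add: norm_mult)
qed

lemma exp_neg_18_le: "exp (- 18 :: real) \<le> 1 / 1000"
proof -
  have "(2::real) ^ 18 \<le> exp 1 ^ 18"
    using exp_ge_add_one_self[of "1::real"] by (intro power_mono) auto
  then have "1000 \<le> exp (18 :: real)"
    by (simp add: exp_of_nat_mult[symmetric])
  then show ?thesis by (simp add: exp_minus field_simps)
qed

text \<open>Makes the smallness condition of the integer Gaussian estimates available from
  \<open>\<beta> = 1\<close> on; \<open>18\<close> comes from
  \<open>pi\<^sup>2 \<ge> 9\<close>.\<close>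

lemma exp_neg_pi2_le:
  assumes "1 \<le> \<beta>"
  shows "exp (- ((2 * pi)\<^sup>2 * \<beta> / 2)) \<le> 1 / 1000"
proof -
  have "3\<^sup>2 \<le> pi\<^sup>2" using pi_gt3 by (intro power_mono) auto
  then have "9 * 1 \<le> pi\<^sup>2 * \<beta>" using assms by (intro mult_mono) auto
  then have "9 \<le> \<beta> * pi\<^sup>2" by (simp add: mult.commute)
  then have "exp (- ((2 * pi)\<^sup>2 * \<beta> / 2)) \<le> exp (- 18)"
    by (simp add: power_mult_distrib)
  then show ?thesis using exp_neg_18_le by linarith
qed

lemma cmod_complex_villain_weight_le_error:
  assumes \<beta>: "1 \<le> \<beta>" and s: "\<bar>2 * pi * \<beta> * s\<bar> \<le> 1"
  shows "cmod (complex_villain_weight \<beta> (Complex t s)) \<le>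
    exp (\<beta> / 2 * (1 - M_error \<beta> / 2) * s\<^sup>2) * villain_weight \<beta> t"
proof -
  define b r where "b = (2 * pi)\<^sup>2 * \<beta>" and "r = exp (- (b / 2))"
  have b: "0 < b" using \<beta> by (simp add: b_def)
  have r: "r \<le> 1 / 1000" using exp_neg_pi2_le[OF \<beta>] by (simp add: r_def b_def)
  have "cmod (\<Sum>\<^sub>\<infinity>k. of_real (gauss_weight b (- (t / (2 * pi))) k) * cis (- (2 * pi * \<beta> * s) * of_int k))
      \<le> villain_weight \<beta> t * exp (- (16 / 25 * r * (2 * pi * \<beta> * s)\<^sup>2))"
    using gauss_characteristic_le[OF b r[unfolded r_def], of "- (2 * pi * \<beta> * s)" "- (t / (2 * pi))"] s
    by (simp add: villain_weight_eq_infsum b_def r_def)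
  then have "cmod (complex_villain_weight \<beta> (Complex t s)) \<le>
      exp (\<beta> / 2 * s\<^sup>2) * (villain_weight \<beta> t * exp (- (16 / 25 * r * (2 * pi * \<beta> * s)\<^sup>2)))"
    unfolding complex_villain_weight_shift b_def[symmetric] by (simp add: norm_mult)
  also have "\<dots> = exp (\<beta> / 2 * s\<^sup>2 - 16 / 25 * r * (2 * pi * \<beta> * s)\<^sup>2) * villain_weight \<beta> t"
    by (simp only: diff_conv_add_uminus exp_add mult_ac)
  also have "\<dots> \<le> exp (\<beta> / 2 * (1 - M_error \<beta> / 2) * s\<^sup>2) * villain_weight \<beta> t"
  proof -
    \<comment> \<open>A quarter of \<open>201 / 100\<close> is below \<open>16 / 25\<close>: this is
      where the slack between \<open>V / 4\<close> and the Gaussian rate \<open>V / 2\<close> is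
      spent.\<close>
    have "min_Var_IG b / 4 \<le> 16 / 25 * r"
      using min_Var_IG_bounds(2)[OF b r[unfolded r_def]] exp_gt_zero[of "- (b / 2)"]
      unfolding r_def by linarith
    then have "min_Var_IG b / 4 * (2 * pi * \<beta> * s)\<^sup>2 \<le> 16 / 25 * r * (2 * pi * \<beta> * s)\<^sup>2"
      by (rule mult_right_mono) simp
    then have "\<beta> / 2 * s\<^sup>2 - 16 / 25 * r * (2 * pi * \<beta> * s)\<^sup>2 \<le> \<beta> / 2 * (1 - M_error \<beta> / 2) * s\<^sup>2"
      by (simp add: M_error_eq b_def power_mult_distrib power2_eq_square algebra_simps)
    then show ?thesis
      using villain_weight_pos[of \<beta> t] \<beta> by (intro mult_right_mono) auto
  qed
  finally show ?thesis .
qed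

section \<open>Regularity of the weight and translation of the angles\<close>

lemma complex_villain_weight_continuous:
  "0 < \<beta> \<Longrightarrow> continuous_on UNIV (complex_villain_weight \<beta>)"
  by (rule holomorphic_on_imp_continuous_on[OF complex_villain_weight_holomorphic])

lemma villain_weight_continuous:
  assumes "0 < \<beta>"
  shows "continuous_on UNIV (villain_weight \<beta>)"
proof -
  have "continuous_on UNIV (\<lambda>t. Re (complex_villain_weight \<beta> (of_real t)))"
    by (intro continuous_intros continuous_on_compose2[OF complex_villain_weight_continuous[OF assms]]) auto
  then show ?thesis by (simp add: complex_villain_weight_of_real[OF assms])
qed

lemma villain_weight_bounded:
  assumes "0 < \<beta>"
  obtains B where "0 < B" "\<And>t. villain_weight \<beta> t \<le> B"
proof -
  have per: "villain_weight \<beta> (t + 2 * pi) = villain_weight \<beta> t" for t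
    using complex_villain_weight_periodic[of \<beta> "of_real t"]
      complex_villain_weight_of_real[OF assms, of "t + 2 * pi"] complex_villain_weight_of_real[OF assms, of t] by simp
  interpret periodic_fun_simple "villain_weight \<beta>" "2 * pi" by standard (rule per)
  have "compact (villain_weight \<beta> ` {0..2 * pi})"
    by (intro compact_continuous_image continuous_on_subset[OF villain_weight_continuous[OF assms]]) auto
  then have "bounded (villain_weight \<beta> ` {0..2 * pi})"
    by (rule compact_imp_bounded)
  then obtain B where B: "0 < B" "\<And>t. t \<in> {0..2 * pi} \<Longrightarrow> \<bar>villain_weight \<beta> t\<bar> \<le> B"
    unfolding bounded_pos by auto
  have "villain_weight \<beta> t \<le> B" for t
  proof -
    define n where "n = \<lfloor>t / (2 * pi)\<rfloor>"
    have "of_int n \<le> t / (2 * pi)" "t / (2 * pi) \<le> of_int n + 1"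
      unfolding n_def by linarith+
    then have "t - of_int n * (2 * pi) \<in> {0..2 * pi}"
      by (simp add: field_simps)
    moreover have "villain_weight \<beta> (t - of_int n * (2 * pi)) = villain_weight \<beta> t"
      by (rule minus_of_int)
    ultimately show ?thesis using B(2)[of "t - of_int n * (2 * pi)"] by simp
  qed
  with B(1) show ?thesis by (rule that)
qed


text \<open>An entire primitive \<open>F\<close> replaces a rectangular contour: by periodicity of
  \<open>f\<close> the increment \<open>F (z + 2 pi) - F z\<close> has derivative zero, and the
  integral along every horizontal period is this one constant divided by
  \<open>2 pi\<close>.\<close>

lemma integral_uniform_angle_shift:
  fixes f :: "complex \<Rightarrow> complex"
  assumes hol: "f holomorphic_on UNIV" and per: "\<And>z. f (z + of_real (2 * pi)) = f z"
  shows "(\<integral>t. f (Complex t s) \<partial>uniform_angle) = (\<integral>t. f (of_real t) \<partial>uniform_angle)"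
proof -
  obtain F where F: "\<And>z. (F has_field_derivative f z) (at z)"
    using holomorphic_convex_primitive'[of UNIV f] hol by auto
  have cont: "continuous_on UNIV f" by (rule holomorphic_on_imp_continuous_on[OF hol])
  have "\<exists>c. \<forall>z. F (z + of_real (2 * pi)) - F z = c"
  proof -
    have "((\<lambda>z. F (z + of_real (2 * pi)) - F z) has_field_derivative 0) (at z within UNIV)" for z
    proof -
      have "((\<lambda>z. F (z + of_real (2 * pi))) has_field_derivative f (z + of_real (2 * pi))) (at z)"
        using F[of "z + of_real (2 * pi)"] by (simp add: DERIV_shift)
      from DERIV_diff[OF this F[of z]] show ?thesis by (simp only: per diff_self)
    qed
    then show ?thesis
      using has_field_derivative_zero_constant[of UNIV "\<lambda>z. F (z + of_real (2 * pi)) - F z"] by auto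
  qed
  then obtain c where c: "\<And>z. F (z + of_real (2 * pi)) - F z = c" by blast
  have "(\<integral>t. f (Complex t s) \<partial>uniform_angle) = c / of_real (2 * pi)" for s
  proof -
    define g where "g = (\<lambda>t. f (Complex t s))"
    have line: "Complex t s = of_real t + \<i> * of_real s" for t
      by (simp add: complex_eq_iff)
    have gc: "continuous_on UNIV g"
      unfolding g_def line by (intro continuous_intros continuous_on_compose2[OF cont]) auto
    then have [measurable]: "g \<in> borel_measurable borel" by (rule borel_measurable_continuous_onI)
    have ind: "(\<lambda>t::real. indicator {0..<2 * pi} t / emeasure lborel {0..<2 * pi}) =
        (\<lambda>t. ennreal (indicator {0..<2 * pi} t / (2 * pi)))"
      by (auto simp: fun_eq_iff divide_ennreal[symmetric] split: split_indicator)
    have "(\<integral>t. g t \<partial>uniform_angle) = (\<integral>t. (indicator {0..<2 * pi} t / (2 * pi)) *\<^sub>R g t \<partial>lborel)"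
      unfolding uniform_measure_def ind by (rule integral_density) auto
    also have "\<dots> = (\<integral>t. (1 / (2 * pi)) *\<^sub>R (indicator {0..2 * pi} t *\<^sub>R g t) \<partial>lborel)"
    proof (rule integral_cong_AE)
      have "AE t in lborel. t \<noteq> 2 * pi" by (rule AE_lborel_singleton)
      then show "AE t in lborel. (indicator {0..<2 * pi} t / (2 * pi)) *\<^sub>R g t =
          (1 / (2 * pi)) *\<^sub>R (indicator {0..2 * pi} t *\<^sub>R g t)"
        by eventually_elim (auto split: split_indicator)
    qed auto
    also have "\<dots> = (1 / (2 * pi)) *\<^sub>R (\<integral>t. indicator {0..2 * pi} t *\<^sub>R g t \<partial>lborel)"
      by (rule integral_scaleR_right)
    also have "(\<integral>t. indicator {0..2 * pi} t *\<^sub>R g t \<partial>lborel) = F (Complex (2 * pi) s) - F (Complex 0 s)"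
    proof (rule integral_FTC_Icc)
      show "continuous_on {0..2 * pi} g" by (rule continuous_on_subset[OF gc]) auto
      fix t :: real
      have "((\<lambda>z. F (z + \<i> * of_real s)) has_field_derivative f (of_real t + \<i> * of_real s)) (at (of_real t))"
        using F[of "of_real t + \<i> * of_real s"] by (simp add: DERIV_shift)
      then show "((\<lambda>t. F (Complex t s)) has_vector_derivative g t) (at t within {0..2 * pi})"
        unfolding g_def line by (rule has_vector_derivative_real_field)
    qed simp
    also have "\<dots> = c"
      using c[of "Complex 0 s"] by (simp add: line add.commute)
    finally show ?thesis by (simp add: g_def scaleR_conv_of_real field_simps)
  qed
  from this[of s] this[of 0] show ?thesis by (simp add: complex_of_real_def[symmetric])
qed

definition pinned_angles :: "'v \<Rightarrow> 'v \<Rightarrow> real measure" where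
  "pinned_angles v\<^sub>0 = (\<lambda>x. if x = v\<^sub>0 then return borel 0 else uniform_angle)"

lemma prob_space_uniform_angle: "prob_space uniform_angle"
  by (rule prob_space_uniform_measure) auto

lemma prob_space_pinned_angles: "prob_space (pinned_angles v\<^sub>0 x)"
  by (simp add: pinned_angles_def prob_space_uniform_angle prob_space_return)

lemma sets_pinned_angles [measurable_cong, simp]: "sets (pinned_angles v\<^sub>0 x) = sets borel"
  by (simp add: pinned_angles_def)

lemma measurable_pinned_component:
  "x \<in> V \<Longrightarrow> (\<lambda>\<theta>. \<theta> x) \<in> borel_measurable (PiM V (pinned_angles v\<^sub>0))"
  using measurable_component_singleton[of x V "pinned_angles v\<^sub>0"]
  by (simp add: measurable_cong_sets[OF refl sets_pinned_angles])

text \<open>The contour of every angle is moved in turn; the pinned vertex must stay where it is.\<close>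

lemma integral_pinned_angles_shift:
  fixes F :: "('v \<Rightarrow> complex) \<Rightarrow> complex" and h :: "'v \<Rightarrow> real"
  assumes V: "finite V" and h0: "h v\<^sub>0 = 0"
    and hol: "\<And>z x. (\<lambda>t. F (z(x := t))) holomorphic_on UNIV"
    and per: "\<And>z x. F (z(x := z x + of_real (2 * pi))) = F z"
    and meas: "\<And>g. (\<lambda>\<theta>. F (\<lambda>x. Complex (\<theta> x) (g x))) \<in> borel_measurable (PiM V (pinned_angles v\<^sub>0))"
    and bound: "\<And>g. \<exists>B. \<forall>\<theta>. cmod (F (\<lambda>x. Complex (\<theta> x) (g x))) \<le> B"
    and local: "\<And>z w. (\<And>x. x \<in> V \<Longrightarrow> z x = w x) \<Longrightarrow> F z = F w"
  shows "(\<integral>\<theta>. F (\<lambda>x. Complex (\<theta> x) (h x)) \<partial>PiM V (pinned_angles v\<^sub>0)) =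
    (\<integral>\<theta>. F (\<lambda>x. of_real (\<theta> x)) \<partial>PiM V (pinned_angles v\<^sub>0))"
proof -
  define J where "J = (\<lambda>S. \<integral>\<theta>. F (\<lambda>x. Complex (\<theta> x) (if x \<in> S then h x else 0)) \<partial>PiM V (pinned_angles v\<^sub>0))"
  interpret product_prob_space "pinned_angles v\<^sub>0" V
    by (intro product_prob_spaceI prob_space_pinned_angles)
  have int: "integrable (PiM V (pinned_angles v\<^sub>0)) (\<lambda>\<theta>. F (\<lambda>x. Complex (\<theta> x) (g x)))" for g
  proof -
    interpret P: prob_space "PiM V (pinned_angles v\<^sub>0)"
      by (intro prob_space_PiM prob_space_pinned_angles)
    obtain B where "\<And>\<theta>. cmod (F (\<lambda>x. Complex (\<theta> x) (g x))) \<le> B" using bound[of g] by blast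
    then have "AE \<theta> in PiM V (pinned_angles v\<^sub>0). cmod (F (\<lambda>x. Complex (\<theta> x) (g x))) \<le> B"
      by (intro AE_I2)
    then show ?thesis by (rule P.integrable_const_bound[OF _ meas])
  qed
  have step: "J (insert x S) = J S" if x: "x \<in> V" "x \<notin> S" "x \<noteq> v\<^sub>0" for x S
  proof -
    have V': "insert x (V - {x}) = V" "finite (V - {x})" "x \<notin> V - {x}" using x V by auto
    have fubini: "(\<integral>\<theta>. F (\<lambda>y. Complex (\<theta> y) (g y)) \<partial>PiM V (pinned_angles v\<^sub>0)) =
        (\<integral>\<theta>. (\<integral>t. F (\<lambda>y. Complex ((\<theta>(x := t)) y) (g y)) \<partial>uniform_angle) \<partial>PiM (V - {x}) (pinned_angles v\<^sub>0))" for g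
      using product_integral_insert[OF V'(2,3), of "\<lambda>\<theta>. F (\<lambda>y. Complex (\<theta> y) (g y))"] int[of g] x(3)
      unfolding V'(1) by (simp only: pinned_angles_def if_False)
    have "(\<integral>t. F (\<lambda>y. Complex ((\<theta>(x := t)) y) (if y \<in> insert x S then h y else 0)) \<partial>uniform_angle) =
        (\<integral>t. F (\<lambda>y. Complex ((\<theta>(x := t)) y) (if y \<in> S then h y else 0)) \<partial>uniform_angle)" for \<theta>
    proof -
      define z where "z = (\<lambda>y. Complex (\<theta> y) (if y \<in> S then h y else 0))"
      have "(\<lambda>y. Complex ((\<theta>(x := t)) y) (if y \<in> insert x S then h y else 0)) = z(x := Complex t (h x))"
        "(\<lambda>y. Complex ((\<theta>(x := t)) y) (if y \<in> S then h y else 0)) = z(x := of_real t)" for t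
        using x(2) by (auto simp: z_def fun_eq_iff complex_eq_iff)
      moreover have "(\<integral>t. F (z(x := Complex t (h x))) \<partial>uniform_angle) = (\<integral>t. F (z(x := of_real t)) \<partial>uniform_angle)"
      proof (rule integral_uniform_angle_shift[OF hol])
        show "F (z(x := u + of_real (2 * pi))) = F (z(x := u))" for u
          using per[of "z(x := u)" x] by (simp only: fun_upd_same fun_upd_upd)
      qed
      ultimately show ?thesis by (simp only:)
    qed
    then show ?thesis unfolding J_def fubini by (simp only:)
  qed
  have collapse: "J S = J {}" if "finite S" "S \<subseteq> V - {v\<^sub>0}" for S
    using that by (induction S rule: finite_induct) (auto simp: step)
  have "J (V - {v\<^sub>0}) = J {}" by (rule collapse) (use V in auto)
  moreover have "J (V - {v\<^sub>0}) = (\<integral>\<theta>. F (\<lambda>x. Complex (\<theta> x) (h x)) \<partial>PiM V (pinned_angles v\<^sub>0))"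
  proof -
    \<comment> \<open>Outside \<open>V\<close> the two configurations may differ;
      \<open>local\<close> makes this invisible to \<open>F\<close>.\<close>
    have "F (\<lambda>x. Complex (\<theta> x) (if x \<in> V - {v\<^sub>0} then h x else 0)) = F (\<lambda>x. Complex (\<theta> x) (h x))" for \<theta>
      by (rule local) (simp add: h0)
    then show ?thesis by (simp only: J_def)
  qed
  moreover have "J {} = (\<integral>\<theta>. F (\<lambda>x. of_real (\<theta> x)) \<partial>PiM V (pinned_angles v\<^sub>0))"
    by (simp only: J_def empty_iff if_False complex_of_real_def)
  ultimately show ?thesis by (simp only:)
qed

lemma complex_villain_weight_periodic_diff:
  "complex_villain_weight \<beta> (z - of_real (2 * pi)) = complex_villain_weight \<beta> z"
  using complex_villain_weight_periodic[of \<beta> "z - of_real (2 * pi)"] by simp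

text \<open>
  McBryan--Spencer bound: after the contour shift \<open>\<theta> \<mapsto> \<theta> + i h\<close> the observable contributes
  \<open>exp (h v - h v\<^sub>0)\<close> and every edge its share of the Dirichlet energy of \<open>h\<close>.
\<close>

lemma villain_model_correlation_le:
  fixes V :: "'v set" and h :: "'v \<Rightarrow> real"
  assumes V: "finite V" "v\<^sub>0 \<in> V" "v \<in> V" and \<beta>: "1 \<le> \<beta>"
    and E: "finite E" "\<And>e. e \<in> E \<Longrightarrow> e = {s e, t e}" "\<And>e. e \<in> E \<Longrightarrow> s e \<in> V" "\<And>e. e \<in> E \<Longrightarrow> t e \<in> V"
    and h: "\<And>e. e \<in> E \<Longrightarrow> \<bar>2 * pi * \<beta> * (h (s e) - h (t e))\<bar> \<le> 1"
  shows "\<bar>\<integral>\<theta>. cos (\<theta> v\<^sub>0 - \<theta> v) \<partial>villain_model V E v\<^sub>0 \<beta>\<bar> \<le>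
    exp (h v - h v\<^sub>0 + \<beta> / 2 * (1 - M_error \<beta> / 2) * (\<Sum>e\<in>E. (h (s e) - h (t e))\<^sup>2))"
proof -
  define P where "P = PiM V (pinned_angles v\<^sub>0)"
  define w where "w = (\<lambda>\<theta>. \<Prod>e\<in>E. villain_weight \<beta> (\<theta> (s e) - \<theta> (t e)))"
  define F where "F = (\<lambda>z. exp (\<i> * (z v\<^sub>0 - z v)) * (\<Prod>e\<in>E. complex_villain_weight \<beta> (z (s e) - z (t e))))"
  \<comment> \<open>Subtracting a constant leaves the edge differences alone and makes the shift
    vanish at the pinned vertex.\<close>
  define k where "k = (\<lambda>x. h x - h v\<^sub>0)"
  define C where "C = exp (h v - h v\<^sub>0 + \<beta> / 2 * (1 - M_error \<beta> / 2) * (\<Sum>e\<in>E. (h (s e) - h (t e))\<^sup>2))"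
  have \<beta>0: "0 < \<beta>" using \<beta> by simp
  interpret P: prob_space P
    unfolding P_def by (intro prob_space_PiM prob_space_pinned_angles)
  have comp: "(\<lambda>\<theta>. \<theta> x) \<in> borel_measurable P" if "x \<in> V" for x
    unfolding P_def by (rule measurable_pinned_component[OF that])
  note [measurable] = comp[OF V(2)] comp[OF V(3)]
  have [measurable]: "villain_weight \<beta> \<in> borel_measurable borel"
    by (rule borel_measurable_continuous_onI[OF villain_weight_continuous[OF \<beta>0]])
  have [measurable]: "complex_villain_weight \<beta> \<in> borel_measurable borel"
    by (rule borel_measurable_continuous_onI[OF complex_villain_weight_continuous[OF \<beta>0]])
  have w_meas [measurable]: "w \<in> borel_measurable P"
    unfolding w_def
  proof (rule borel_measurable_prod)
    fix e assume "e \<in> E"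
    note [measurable] = comp[OF E(3)[OF this]] comp[OF E(4)[OF this]]
    show "(\<lambda>\<theta>. villain_weight \<beta> (\<theta> (s e) - \<theta> (t e))) \<in> borel_measurable P" by measurable
  qed
  have w_nonneg: "0 \<le> w \<theta>" for \<theta>
    unfolding w_def using villain_weight_pos[OF \<beta>0] by (intro prod_nonneg) (simp add: less_imp_le)
  obtain B where B: "0 < B" "\<And>t. villain_weight \<beta> t \<le> B" using villain_weight_bounded[OF \<beta>0] by blast
  have w_le: "w \<theta> \<le> B ^ card E" for \<theta>
    unfolding w_def prod_constant[symmetric]
    using villain_weight_pos[OF \<beta>0] B by (intro prod_mono) (simp add: less_imp_le)
  have w_int: "integrable P w"
    by (rule P.integrable_const_bound[of _ "B ^ card E"]) (use w_le w_nonneg in auto)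
  have cF: "complex_of_real a - of_real b = of_real (a - b)" "Complex a c - Complex b d = Complex (a - b) (c - d)" for a b c d
    by (simp_all add: complex_eq_iff)
  have meas: "(\<lambda>\<theta>. F (\<lambda>x. Complex (\<theta> x) (g x))) \<in> borel_measurable P" for g
  proof -
    have "(\<lambda>\<theta>. \<Prod>e\<in>E. complex_villain_weight \<beta> (Complex (\<theta> (s e)) (g (s e)) - Complex (\<theta> (t e)) (g (t e)))) \<in> borel_measurable P"
    proof (rule borel_measurable_prod)
      fix e assume "e \<in> E"
      note [measurable] = comp[OF E(3)[OF this]] comp[OF E(4)[OF this]]
      show "(\<lambda>\<theta>. complex_villain_weight \<beta> (Complex (\<theta> (s e)) (g (s e)) - Complex (\<theta> (t e)) (g (t e)))) \<in> borel_measurable P"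
        unfolding Complex_eq by measurable
    qed
    then show ?thesis unfolding F_def Complex_eq by measurable
  qed
  \<comment> \<open>This crude bound, for arbitrary \<open>g\<close>, feeds the boundedness
    condition of the contour shift. The sharp bound \<open>F_norm_k\<close> needs small slopes and
    is kept for the final estimate.\<close>
  have F_norm: "cmod (F (\<lambda>x. Complex (\<theta> x) (g x))) \<le>
      exp (g v - g v\<^sub>0) * (\<Prod>e\<in>E. exp (\<beta> / 2 * (g (s e) - g (t e))\<^sup>2)) * w \<theta>" for \<theta> g
  proof -
    have "(\<Prod>e\<in>E. cmod (complex_villain_weight \<beta> (Complex (\<theta> (s e) - \<theta> (t e)) (g (s e) - g (t e))))) \<le>
        (\<Prod>e\<in>E. exp (\<beta> / 2 * (g (s e) - g (t e))\<^sup>2) * villain_weight \<beta> (\<theta> (s e) - \<theta> (t e)))"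
      by (intro prod_mono conjI cmod_complex_villain_weight_le[OF \<beta>0]) simp
    then show ?thesis
      unfolding F_def w_def by (simp add: norm_mult prod_norm[symmetric] cF prod.distrib mult.assoc)
  qed
  have F_norm_k: "cmod (F (\<lambda>x. Complex (\<theta> x) (k x))) \<le> C * w \<theta>" for \<theta>
  proof -
    have "(\<Prod>e\<in>E. cmod (complex_villain_weight \<beta> (Complex (\<theta> (s e) - \<theta> (t e)) (k (s e) - k (t e))))) \<le>
        (\<Prod>e\<in>E. exp (\<beta> / 2 * (1 - M_error \<beta> / 2) * (k (s e) - k (t e))\<^sup>2) * villain_weight \<beta> (\<theta> (s e) - \<theta> (t e)))"
      by (intro prod_mono conjI cmod_complex_villain_weight_le_error[OF \<beta>]) (use h in \<open>auto simp: k_def\<close>)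
    also have "\<dots> = exp (\<beta> / 2 * (1 - M_error \<beta> / 2) * (\<Sum>e\<in>E. (h (s e) - h (t e))\<^sup>2)) * w \<theta>"
      by (simp add: prod.distrib w_def exp_sum[OF E(1), symmetric] sum_distrib_left k_def)
    finally show ?thesis
      unfolding F_def C_def exp_add by (simp add: norm_mult prod_norm[symmetric] cF mult.assoc k_def)
  qed
  have shift: "(\<integral>\<theta>. F (\<lambda>x. Complex (\<theta> x) (k x)) \<partial>P) = (\<integral>\<theta>. F (\<lambda>x. of_real (\<theta> x)) \<partial>P)"
    unfolding P_def
  proof (rule integral_pinned_angles_shift[OF V(1)])
    show "k v\<^sub>0 = 0" by (simp add: k_def)
    show "(\<lambda>\<theta>. F (\<lambda>x. Complex (\<theta> x) (g x))) \<in> borel_measurable (PiM V (pinned_angles v\<^sub>0))" for g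
      using meas[of g] by (simp add: P_def)
    show "(\<lambda>u. F (z(x := u))) holomorphic_on UNIV" for z x
    proof -
      have c: "(\<lambda>u. (z(x := u)) y) holomorphic_on UNIV" for y
        by (cases "y = x") (auto intro: holomorphic_intros)
      have "(complex_villain_weight \<beta> \<circ> (\<lambda>u. (z(x := u)) y - (z(x := u)) y')) holomorphic_on UNIV" for y y'
        by (rule holomorphic_on_compose_gen[OF _ complex_villain_weight_holomorphic[OF \<beta>0]])
          (intro holomorphic_intros c, auto)
      then show ?thesis
        unfolding F_def by (intro holomorphic_intros c) (simp add: o_def)
    qed
    show "F (z(x := z x + of_real (2 * pi))) = F z" for z x
    proof -
      define z' where "z' = z(x := z x + of_real (2 * pi))"
      \<comment> \<open>Moving one coordinate by a period changes a difference of coordinates by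
        \<open>0\<close> or by a period of either sign.\<close>
      have diff: "z' y - z' y' = z y - z y' \<or> z' y - z' y' = z y - z y' + of_real (2 * pi) \<or>
          z' y - z' y' = z y - z y' - of_real (2 * pi)" for y y'
        by (auto simp: z'_def)
      have "complex_villain_weight \<beta> (z' y - z' y') = complex_villain_weight \<beta> (z y - z y')" for y y'
        using diff[of y y']
        by (elim disjE; simp only: complex_villain_weight_periodic complex_villain_weight_periodic_diff)
      moreover have "exp (\<i> * (z' v\<^sub>0 - z' v)) = exp (\<i> * (z v\<^sub>0 - z v))"
      proof -
        have *: "exp (\<i> * (u + of_real (2 * pi))) = exp (\<i> * u)" for u
          using exp_two_pi_i by (simp add: distrib_left exp_add mult_ac)
        have **: "exp (\<i> * (u - of_real (2 * pi))) = exp (\<i> * u)" for u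
          using *[of "u - of_real (2 * pi)"] by (simp only: diff_add_cancel)
        show ?thesis
          using diff[of v\<^sub>0 v] by (elim disjE; simp only: * **)
      qed
      ultimately show ?thesis unfolding F_def z'_def[symmetric] by simp
    qed
    show "\<exists>B. \<forall>\<theta>. cmod (F (\<lambda>x. Complex (\<theta> x) (g x))) \<le> B" for g
    proof (intro exI allI)
      fix \<theta> :: "'v \<Rightarrow> real"
      have "exp (g v - g v\<^sub>0) * (\<Prod>e\<in>E. exp (\<beta> / 2 * (g (s e) - g (t e))\<^sup>2)) * w \<theta> \<le>
          exp (g v - g v\<^sub>0) * (\<Prod>e\<in>E. exp (\<beta> / 2 * (g (s e) - g (t e))\<^sup>2)) * B ^ card E"
        by (intro mult_left_mono w_le mult_nonneg_nonneg prod_nonneg) auto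
      with F_norm show "cmod (F (\<lambda>x. Complex (\<theta> x) (g x))) \<le>
          exp (g v - g v\<^sub>0) * (\<Prod>e\<in>E. exp (\<beta> / 2 * (g (s e) - g (t e))\<^sup>2)) * B ^ card E"
        by (rule order_trans)
    qed
    show "F z = F z'" if "\<And>x. x \<in> V \<Longrightarrow> z x = z' x" for z z'
      unfolding F_def using that V E(3,4) by (simp cong: prod.cong)
  qed
  define Z where "Z = (\<integral>\<theta>. w \<theta> \<partial>P)"
  have Z: "0 \<le> Z" unfolding Z_def by (rule integral_nonneg_AE) (simp add: w_nonneg)
  have F_real: "F (\<lambda>x. of_real (\<theta> x)) = of_real (w \<theta>) * cis (\<theta> v\<^sub>0 - \<theta> v)" for \<theta>
    unfolding F_def w_def cF complex_villain_weight_of_real[OF \<beta>0] by (simp add: cis_conv_exp)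
  have F_real_int: "integrable P (\<lambda>\<theta>. F (\<lambda>x. of_real (\<theta> x)))"
  proof (rule Bochner_Integration.integrable_bound[OF w_int])
    show "(\<lambda>\<theta>. F (\<lambda>x. of_real (\<theta> x))) \<in> borel_measurable P"
      using meas[of "\<lambda>_. 0"] by (simp add: complex_of_real_def[symmetric])
  qed (simp add: F_real norm_mult)
  have "(\<integral>\<theta>. cos (\<theta> v\<^sub>0 - \<theta> v) \<partial>villain_model V E v\<^sub>0 \<beta>) = (\<integral>\<theta>. w \<theta> / Z * cos (\<theta> v\<^sub>0 - \<theta> v) \<partial>P)"
  proof -
    have edge: "(\<Prod>e\<in>E. villain_edge \<beta> \<theta> e) = w \<theta>" for \<theta>
      unfolding w_def
    proof (intro prod.cong refl)
      fix e assume "e \<in> E"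
      then show "villain_edge \<beta> \<theta> e = villain_weight \<beta> (\<theta> (s e) - \<theta> (t e))"
        using villain_edge_pair[of \<beta> \<theta> "s e" "t e"] by (simp only: E(2)[symmetric])
    qed
    show ?thesis
      unfolding villain_model_def normalised_density_def edge pinned_angles_def[symmetric] P_def[symmetric]
        Z_def[symmetric]
      by (rule integral_real_density) (use Z w_nonneg in auto)
  qed
  also have "\<dots> = (\<integral>\<theta>. w \<theta> * cos (\<theta> v\<^sub>0 - \<theta> v) \<partial>P) / Z"
    by (simp add: times_divide_eq_left)
  also have "(\<integral>\<theta>. w \<theta> * cos (\<theta> v\<^sub>0 - \<theta> v) \<partial>P) = Re (\<integral>\<theta>. F (\<lambda>x. of_real (\<theta> x)) \<partial>P)"
    by (subst integral_Re[symmetric, OF F_real_int]) (simp add: F_real)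
  also have "\<bar>\<dots> / Z\<bar> \<le> C"
  proof -
    have "\<bar>Re (\<integral>\<theta>. F (\<lambda>x. of_real (\<theta> x)) \<partial>P)\<bar> \<le> cmod (\<integral>\<theta>. F (\<lambda>x. Complex (\<theta> x) (k x)) \<partial>P)"
      unfolding shift by (rule abs_Re_le_cmod)
    also have "\<dots> \<le> (\<integral>\<theta>. C * w \<theta> \<partial>P)"
    proof (rule order_trans[OF integral_norm_bound])
      have Cw: "integrable P (\<lambda>\<theta>. C * w \<theta>)" using w_int by simp
      have "integrable P (\<lambda>\<theta>. F (\<lambda>x. Complex (\<theta> x) (k x)))"
        using F_norm_k order_trans[OF F_norm_k abs_ge_self]
        by (intro Bochner_Integration.integrable_bound[OF Cw meas]) simp
      then show "(\<integral>\<theta>. cmod (F (\<lambda>x. Complex (\<theta> x) (k x))) \<partial>P) \<le> (\<integral>\<theta>. C * w \<theta> \<partial>P)"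
        by (intro integral_mono integrable_norm Cw F_norm_k)
    qed
    also have "\<dots> = C * Z" by (simp add: Z_def)
    \<comment> \<open>If \<open>Z = 0\<close>, the quotient is \<open>0\<close> by the convention on
      division.\<close>
    finally show ?thesis
      using Z by (cases "Z = 0") (auto simp: C_def divide_le_eq)
  qed
  finally show ?thesis by (simp add: C_def)
qed

section \<open>The lattice logarithm\<close>

definition site_sqnorm :: "site \<Rightarrow> real" where
  "site_sqnorm x = (real_of_int (fst x))\<^sup>2 + (real_of_int (snd x))\<^sup>2"

lemma lattice_norm_sqrt: "lattice_norm x = sqrt (site_sqnorm x)"
  by (simp add: lattice_norm_def site_sqnorm_def)

lemma site_sqnorm_nonneg [simp]: "0 \<le> site_sqnorm x"
  by (simp add: site_sqnorm_def)

lemma site_sqnorm_ge_1: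
  assumes "x \<noteq> 0"
  shows "1 \<le> site_sqnorm x"
proof -
  have "fst x \<noteq> 0 \<or> snd x \<noteq> 0" using assms by (auto simp: prod_eq_iff)
  then have "0 < (fst x)\<^sup>2 \<or> 0 < (snd x)\<^sup>2" by simp
  then have "1 \<le> (fst x)\<^sup>2 + (snd x)\<^sup>2"
    using zero_le_power2[of "fst x"] zero_le_power2[of "snd x"] by linarith
  then have "real_of_int 1 \<le> real_of_int ((fst x)\<^sup>2 + (snd x)\<^sup>2)" by (simp only: of_int_le_iff)
  then show ?thesis by (simp add: site_sqnorm_def)
qed

lemma site_sqnorm_minus [simp]: "site_sqnorm (- x) = site_sqnorm x"
  by (simp add: site_sqnorm_def)

text \<open>Indexed by the squared radius, so that the points added from \<open>j\<close> to
  \<open>Suc j\<close> all have squared norm exactly \<open>j + 1\<close>.\<close>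

definition lattice_disc :: "nat \<Rightarrow> site set" where
  "lattice_disc j = {x. (fst x)\<^sup>2 + (snd x)\<^sup>2 \<le> int j}"

lemma mem_lattice_disc_iff: "x \<in> lattice_disc j \<longleftrightarrow> site_sqnorm x \<le> real j"
proof -
  have "site_sqnorm x = real_of_int ((fst x)\<^sup>2 + (snd x)\<^sup>2)" by (simp add: site_sqnorm_def)
  moreover have "real j = real_of_int (int j)" by simp
  ultimately show ?thesis
    by (simp only: lattice_disc_def mem_Collect_eq of_int_le_iff)
qed

lemma finite_lattice_disc: "finite (lattice_disc j)"
proof (rule finite_subset)
  show "lattice_disc j \<subseteq> {- int j..int j} \<times> {- int j..int j}"
  proof
    fix x assume x: "x \<in> lattice_disc j"
    have abs: "\<bar>a\<bar> \<le> a\<^sup>2" for a :: int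
    proof (cases "a = 0")
      case False
      then have "\<bar>a\<bar> * 1 \<le> \<bar>a\<bar> * \<bar>a\<bar>" by (intro mult_left_mono) auto
      then show ?thesis by (simp only: mult_1_right abs_mult_self_eq power2_eq_square)
    qed simp
    have "(fst x)\<^sup>2 + (snd x)\<^sup>2 \<le> int j" using x by (simp add: lattice_disc_def)
    then have "\<bar>fst x\<bar> \<le> int j \<and> \<bar>snd x\<bar> \<le> int j"
      using abs[of "fst x"] abs[of "snd x"] zero_le_power2[of "fst x"] zero_le_power2[of "snd x"] by linarith
    then show "x \<in> {- int j..int j} \<times> {- int j..int j}" by (cases x) auto
  qed
qed auto

text \<open>Unit squares attached to the lattice points fill a disc of slightly larger radius.\<close>

lemma card_lattice_disc_le: "real (card (lattice_disc j)) \<le> pi * (sqrt (real j) + 2)\<^sup>2"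
proof -
  define Q where "Q = (\<lambda>x::site. {real_of_int (fst x)..<real_of_int (fst x) + 1} \<times> {real_of_int (snd x)..<real_of_int (snd x) + 1})"
  have Q: "emeasure lborel (Q x) = 1" for x
    unfolding Q_def lborel_prod[symmetric] by (subst lborel.emeasure_pair_measure_Times) auto
  have Q_sets: "Q x \<in> sets lborel" for x
    unfolding Q_def lborel_prod[symmetric] by auto
  have "x = y" if "p \<in> Q x" "p \<in> Q y" for p x y
  proof -
    have "\<lfloor>fst p\<rfloor> = fst x" "\<lfloor>snd p\<rfloor> = snd x" "\<lfloor>fst p\<rfloor> = fst y" "\<lfloor>snd p\<rfloor> = snd y"
      using that by (auto simp: Q_def floor_eq_iff)
    then show ?thesis by (simp add: prod_eq_iff)
  qed
  then have disj: "disjoint_family_on Q (lattice_disc j)"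
    by (auto simp: disjoint_family_on_def)
  have "ennreal (real (card (lattice_disc j))) = (\<Sum>x\<in>lattice_disc j. emeasure lborel (Q x))"
    by (simp add: Q ennreal_of_nat_eq_real_of_nat)
  also have "\<dots> = emeasure lborel (\<Union>x\<in>lattice_disc j. Q x)"
    by (rule sum_emeasure) (use Q_sets disj finite_lattice_disc in auto)
  also have "\<dots> \<le> emeasure lborel (cball (0 :: real \<times> real) (sqrt (real j) + 2))"
  proof (rule emeasure_mono)
    show "(\<Union>x\<in>lattice_disc j. Q x) \<subseteq> cball 0 (sqrt (real j) + 2)"
    proof clarify
      fix x p assume x: "x \<in> lattice_disc j" and p: "p \<in> Q x"
      define c :: "real \<times> real" where "c = (of_int (fst x), of_int (snd x))"
      have "norm c = sqrt (site_sqnorm x)" by (simp add: c_def norm_Pair site_sqnorm_def)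
      then have "norm c \<le> sqrt (real j)" using x by (simp add: mem_lattice_disc_iff)
      \<comment> \<open>A unit square reaches at most \<open>2\<close> from its corner in the sum of
        coordinates; the excess only affects the boundary term of the count.\<close>
      moreover have "norm (p - c) \<le> norm (fst (p - c)) + norm (snd (p - c))"
        using norm_Pair_le[of "fst (p - c)" "snd (p - c)"] by (simp only: prod.collapse)
      moreover have "norm (fst (p - c)) \<le> 1" "norm (snd (p - c)) \<le> 1"
        using p by (auto simp: c_def Q_def)
      ultimately have "norm c + norm (p - c) \<le> sqrt (real j) + 2" by linarith
      then have "norm p \<le> sqrt (real j) + 2"
        using norm_triangle_ineq[of c "p - c"] by simp
      then show "p \<in> cball 0 (sqrt (real j) + 2)" by simp
    qed
  qed auto
  also have "\<dots> = ennreal (pi * (sqrt (real j) + 2)\<^sup>2)"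
    by (subst emeasure_cball) (auto simp: unit_ball_vol_2 power2_eq_square)
  finally show ?thesis
    by (simp add: ennreal_le_iff)
qed

text \<open>Abel summation over shells: the weight drops by \<open>1 / (j + 1) - 1 / (j + 2)\<close>
  from one squared radius to the next, so that only the number of points in each disc has to be
  estimated.\<close>

lemma sum_lattice_disc_by_parts:
  "(\<Sum>x\<in>lattice_disc n. 1 / (1 + site_sqnorm x)) =
    real (card (lattice_disc n)) / (real n + 1) +
    (\<Sum>j<n. real (card (lattice_disc j)) / ((real j + 1) * (real j + 2)))"
proof (induction n)
  case 0
  have "site_sqnorm x = 0" if "x \<in> lattice_disc 0" for x
    using that site_sqnorm_nonneg[of x] by (simp add: mem_lattice_disc_iff del: site_sqnorm_nonneg)
  then show ?case by simp
next
  case (Suc n)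
  have sub: "lattice_disc n \<subseteq> lattice_disc (Suc n)" by (auto simp: lattice_disc_def)
  define N N' where "N = real (card (lattice_disc n))" and "N' = real (card (lattice_disc (Suc n)))"
  have "site_sqnorm x = real n + 1" if "x \<in> lattice_disc (Suc n) - lattice_disc n" for x
  proof -
    have "(fst x)\<^sup>2 + (snd x)\<^sup>2 = int n + 1" using that by (auto simp: lattice_disc_def)
    then have "real_of_int ((fst x)\<^sup>2 + (snd x)\<^sup>2) = real_of_int (int n + 1)" by (simp only:)
    then show ?thesis by (simp add: site_sqnorm_def)
  qed
  then have "(\<Sum>x\<in>lattice_disc (Suc n) - lattice_disc n. 1 / (1 + site_sqnorm x)) =
      (\<Sum>x\<in>lattice_disc (Suc n) - lattice_disc n. 1 / (real n + 2))"
    by (intro sum.cong) auto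
  also have "\<dots> = (N' - N) / (real n + 2)"
    using card_mono[OF finite_lattice_disc sub]
    by (simp add: card_Diff_subset[OF finite_lattice_disc sub] N_def N'_def of_nat_diff)
  finally have shell: "(\<Sum>x\<in>lattice_disc (Suc n) - lattice_disc n. 1 / (1 + site_sqnorm x)) = (N' - N) / (real n + 2)" .
  have "(\<Sum>x\<in>lattice_disc (Suc n). 1 / (1 + site_sqnorm x)) =
      (N' - N) / (real n + 2) + (\<Sum>x\<in>lattice_disc n. 1 / (1 + site_sqnorm x))"
    using sum.subset_diff[OF sub finite_lattice_disc, of "\<lambda>x. 1 / (1 + site_sqnorm x)"] shell by simp
  also have "\<dots> = N' / (real n + 2) + (N / (real n + 1) - N / (real n + 2) +
      (\<Sum>j<n. real (card (lattice_disc j)) / ((real j + 1) * (real j + 2))))"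
    unfolding Suc.IH N_def[symmetric] by (simp add: diff_divide_distrib)
  also have "N / (real n + 1) - N / (real n + 2) = N / ((real n + 1) * (real n + 2))"
    by (simp add: divide_simps) (simp add: algebra_simps)
  finally show ?case by (simp add: N_def N'_def add.commute)
qed

text \<open>The count \<open>pi * j\<close> against the weight \<open>1 / j\<^sup>2\<close> produces
  a harmonic sum. As \<open>n\<close> is a squared radius, \<open>pi * ln n\<close> is
  \<open>2 * pi\<close> times the logarithm of the radius.\<close>

lemma sum_lattice_disc_le:
  assumes \<eta>: "0 < \<eta>"
  shows "\<exists>C\<ge>0. \<forall>n. (\<Sum>x\<in>lattice_disc n. 1 / (1 + site_sqnorm x)) \<le> pi * (1 + \<eta>) * ln (real n + 1) + C"
proof (intro exI conjI allI)
  \<comment> \<open>Chosen so that \<open>4 * sqrt j \<le> \<eta> * j + 4 / \<eta>\<close> absorbs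
    the boundary term of the lattice point count; the remaining \<open>4\<close> is the square of
    the excess radius.\<close>
  define K where "K = 4 + 4 / \<eta>"
  have K: "0 < K" using \<eta> by (simp add: K_def add_pos_pos)
  show "0 \<le> pi * (1 + \<eta> + K) + pi * K"
    using \<eta> K by (intro add_nonneg_nonneg mult_nonneg_nonneg) auto
  have card: "real (card (lattice_disc j)) \<le> pi * ((1 + \<eta>) * (real j + 1) + K)" for j
  proof -
    have "0 \<le> (sqrt \<eta> * sqrt (real j) - 2 / sqrt \<eta>)\<^sup>2" by simp
    then have "4 * sqrt (real j) \<le> \<eta> * real j + 4 / \<eta>"
      using \<eta> by (simp add: power2_diff power_mult_distrib power_divide)
    then have "(sqrt (real j) + 2)\<^sup>2 \<le> (1 + \<eta>) * (real j + 1) + K"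
      using \<eta> by (simp add: power2_sum K_def algebra_simps)
    then have "pi * (sqrt (real j) + 2)\<^sup>2 \<le> pi * ((1 + \<eta>) * (real j + 1) + K)"
      by (intro mult_left_mono) auto
    then show ?thesis using card_lattice_disc_le[of j] by linarith
  qed
  fix n
  have "real (card (lattice_disc n)) / (real n + 1) \<le> pi * ((1 + \<eta>) * (real n + 1) + K) / (real n + 1)"
    by (rule divide_right_mono[OF card]) simp
  also have "\<dots> = pi * (1 + \<eta> + K / (real n + 1))"
    by (simp add: field_simps)
  also have "\<dots> \<le> pi * (1 + \<eta> + K)"
    using K by (intro mult_left_mono add_left_mono) (auto simp: divide_le_eq)
  finally have first: "real (card (lattice_disc n)) / (real n + 1) \<le> pi * (1 + \<eta> + K)" .
  have "real (card (lattice_disc j)) / ((real j + 1) * (real j + 2)) \<le>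
      pi * (1 + \<eta>) * (1 / (real j + 2)) + pi * K * (1 / (real j + 1) - 1 / (real j + 2))" for j
  proof -
    have "real (card (lattice_disc j)) / ((real j + 1) * (real j + 2)) \<le>
        pi * ((1 + \<eta>) * (real j + 1) + K) / ((real j + 1) * (real j + 2))"
      by (rule divide_right_mono[OF card]) simp
    also have "\<dots> = pi * (1 + \<eta>) * (1 / (real j + 2)) + pi * K * (1 / (real j + 1) - 1 / (real j + 2))"
      by (simp add: divide_simps) (simp add: algebra_simps)
    finally show ?thesis .
  qed
  then have "(\<Sum>j<n. real (card (lattice_disc j)) / ((real j + 1) * (real j + 2))) \<le>
      (\<Sum>j<n. pi * (1 + \<eta>) * (1 / (real j + 2)) + pi * K * (1 / (real j + 1) - 1 / (real j + 2)))"
    by (rule sum_mono)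
  also have "\<dots> = pi * (1 + \<eta>) * (\<Sum>j<n. 1 / (real j + 2)) + pi * K * (\<Sum>j<n. 1 / (real j + 1) - 1 / (real j + 2))"
    by (simp only: sum.distrib sum_distrib_left)
  also have "(\<Sum>j<n. 1 / (real j + 1) - 1 / (real j + 2)) = 1 - 1 / (real n + 1)"
    by (induction n) (auto simp: add_ac)
  also have "pi * (1 + \<eta>) * (\<Sum>j<n. 1 / (real j + 2)) + pi * K * (1 - 1 / (real n + 1)) \<le>
      pi * (1 + \<eta>) * ln (real n + 1) + pi * K"
  proof (rule add_mono)
    have "(\<Sum>j<n. 1 / (real j + 2)) \<le> ln (real n + 1)"
    proof (induction n)
      case (Suc n)
      have "ln ((real n + 1) / (real n + 2)) \<le> (real n + 1) / (real n + 2) - 1"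
        by (rule ln_le_minus_one) simp
      then have "1 / (real n + 2) \<le> ln (real n + 2) - ln (real n + 1)"
        by (simp add: ln_div field_simps)
      then show ?case using Suc by (simp add: add_ac)
    qed simp
    then show "pi * (1 + \<eta>) * (\<Sum>j<n. 1 / (real j + 2)) \<le> pi * (1 + \<eta>) * ln (real n + 1)"
      using \<eta> by (intro mult_left_mono) auto
    show "pi * K * (1 - 1 / (real n + 1)) \<le> pi * K"
      using K by (intro mult_left_le) auto
  qed
  finally show "(\<Sum>x\<in>lattice_disc n. 1 / (1 + site_sqnorm x)) \<le>
      pi * (1 + \<eta>) * ln (real n + 1) + (pi * (1 + \<eta> + K) + pi * K)"
    unfolding sum_lattice_disc_by_parts using first by linarith
qed

section \<open>Gradient and energy of the truncated logarithm\<close>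

definition axis_steps :: "site set" where
  "axis_steps = {(1, 0), (0, 1)}"

lemma sum_axis_steps: "(\<Sum>d\<in>axis_steps. f d) = f (1, 0) + f (0, 1)"
  by (simp add: axis_steps_def)

text \<open>With only the two positive unit vectors as steps, every edge is charged to one of its
  endpoints, so summing over sites counts it once.\<close>

definition dirichlet_density :: "(site \<Rightarrow> real) \<Rightarrow> site \<Rightarrow> real" where
  "dirichlet_density f x = (\<Sum>d\<in>axis_steps. (f (x + d) - f x)\<^sup>2)"

text \<open>The inequality \<open>ln u \<le> u - 1\<close> for the ratio and for its inverse; both
  denominators are at least \<open>c * A\<close>.\<close>

lemma abs_ln_diff_le:
  fixes A m c :: real
  assumes A: "0 < A" and c: "0 < c" "c \<le> 1" and m: "\<bar>m\<bar> \<le> (1 - c) * A"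
  shows "\<bar>ln (A + m) - ln A\<bar> \<le> \<bar>m\<bar> / (c * A)"
proof -
  have B: "c * A \<le> A + m" using m by (simp add: algebra_simps abs_le_iff)
  have B0: "0 < A + m" using B A c by (smt (verit) mult_pos_pos)
  have cA: "0 < c * A" "c * A \<le> A" using A c by (auto simp: mult_le_cancel_right1)
  have "ln (A + m) - ln A = ln ((A + m) / A)" using A B0 by (simp add: ln_div)
  also have "\<dots> \<le> (A + m) / A - 1" using A B0 by (intro ln_le_minus_one) simp
  also have "\<dots> = m / A" using A by (simp add: field_simps)
  also have "\<dots> \<le> \<bar>m\<bar> / (c * A)" using cA by (intro frac_le) auto
  finally have 1: "ln (A + m) - ln A \<le> \<bar>m\<bar> / (c * A)" .
  have "ln A - ln (A + m) = ln (A / (A + m))" using A B0 by (simp add: ln_div)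
  also have "\<dots> \<le> A / (A + m) - 1" using A B0 by (intro ln_le_minus_one) simp
  also have "\<dots> = (- m) / (A + m)" using B0 by (simp add: field_simps)
  also have "\<dots> \<le> \<bar>m\<bar> / (c * A)" using cA B by (intro frac_le) auto
  finally show ?thesis using 1 by (simp add: abs_le_iff)
qed

text \<open>
  The additive constant \<open>\<kappa> = (3 / \<delta>)\<^sup>2\<close> makes one lattice step change \<open>\<kappa> + |x|\<^sup>2\<close> only by a factor
  in \<open>[1 - \<delta>, 1 + \<delta>]\<close>, so that the discrete gradient of the logarithm is close to the continuous one.
\<close>

definition cut_log :: "real \<Rightarrow> real \<Rightarrow> site \<Rightarrow> real" where
  "cut_log \<delta> T x = max 0 ((ln T - ln ((3 / \<delta>)\<^sup>2 + site_sqnorm x)) / 2)"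

text \<open>One step changes the squared norm by \<open>m = 2 * a + 1\<close> with \<open>a\<close>
  a coordinate, so \<open>\<bar>m\<bar> \<le> 3 * sqrt A\<close>, and
  \<open>sqrt A \<ge> 3 / \<delta>\<close> turns this into \<open>\<delta> * A\<close>. The bound
  \<open>1 / 4\<close> allows \<open>1 / 2\<close> for a difference of two copies. If the squared
  norm is at least \<open>2 * T\<close>, both endpoints lie beyond the cut-off, since a step shrinks
  \<open>A\<close> by less than half.\<close>

lemma cut_log_step:
  fixes \<delta> T :: real and x d :: site
  defines "A \<equiv> (3 / \<delta>)\<^sup>2 + site_sqnorm x"
  assumes \<delta>: "0 < \<delta>" "\<delta> \<le> 1 / 9" and d: "d \<in> axis_steps" and T: "0 < T"
  shows "\<bar>cut_log \<delta> T (x + d) - cut_log \<delta> T x\<bar> \<le> 1 / 4"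
    and "(cut_log \<delta> T (x + d) - cut_log \<delta> T x)\<^sup>2 \<le>
      (site_sqnorm (x + d) - site_sqnorm x)\<^sup>2 / (4 * (1 - \<delta>)\<^sup>2 * A\<^sup>2)"
    and "cut_log \<delta> T (x + d) \<noteq> cut_log \<delta> T x \<Longrightarrow> site_sqnorm x < 2 * T"
proof -
  define m where "m = site_sqnorm (x + d) - site_sqnorm x"
  have k: "27 \<le> 3 / \<delta>" using \<delta> by (simp add: field_simps)
  have k2: "729 \<le> (3 / \<delta>)\<^sup>2" using power_mono[OF k, of 2] by simp
  have A: "0 < A" "729 \<le> A" using k2 site_sqnorm_nonneg[of x] unfolding A_def by linarith+
  have sA: "3 / \<delta> \<le> sqrt A" using k by (intro real_le_rsqrt) (simp add: A_def)
  have coord: "\<bar>real_of_int (fst x)\<bar> \<le> sqrt A" "\<bar>real_of_int (snd x)\<bar> \<le> sqrt A"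
    by (auto intro!: real_le_rsqrt simp: A_def site_sqnorm_def)
  have m_eq: "m = 2 * real_of_int (fst x) + 1 \<or> m = 2 * real_of_int (snd x) + 1"
    using d by (auto simp: m_def axis_steps_def site_sqnorm_def power2_eq_square algebra_simps)
  have "1 \<le> sqrt A" using A by simp
  then have "\<bar>m\<bar> \<le> 3 * sqrt A" using m_eq coord by (elim disjE) linarith+
  also have "\<dots> \<le> \<delta> * sqrt A * sqrt A"
    using sA \<delta> A by (intro mult_right_mono) (auto simp: field_simps)
  finally have m: "\<bar>m\<bar> \<le> \<delta> * A" using A by (simp add: mult.assoc)
  have ln_le: "\<bar>ln (A + m) - ln A\<bar> \<le> \<bar>m\<bar> / ((1 - \<delta>) * A)"
    by (rule abs_ln_diff_le) (use A \<delta> m in auto)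
  have Am: "(3 / \<delta>)\<^sup>2 + site_sqnorm (x + d) = A + m" by (simp add: A_def m_def)
  have diff: "\<bar>cut_log \<delta> T (x + d) - cut_log \<delta> T x\<bar> \<le> \<bar>ln (A + m) - ln A\<bar> / 2"
    unfolding cut_log_def Am A_def[symmetric] by (auto simp: max_def abs_if field_simps)
  also have "\<dots> \<le> \<bar>m\<bar> / ((1 - \<delta>) * A) / 2" by (intro divide_right_mono ln_le) simp
  finally have le: "\<bar>cut_log \<delta> T (x + d) - cut_log \<delta> T x\<bar> \<le> \<bar>m\<bar> / (2 * (1 - \<delta>) * A)"
    by (simp add: field_simps)
  also have "\<dots> \<le> 1 / 4"
  proof -
    have "\<delta> * A \<le> (1 - \<delta>) * A / 2" using A \<delta> by (simp add: field_simps)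
    then have "\<bar>m\<bar> \<le> (1 - \<delta>) * A / 2" using m by linarith
    then show ?thesis using A \<delta> by (simp add: divide_le_eq algebra_simps)
  qed
  finally show "\<bar>cut_log \<delta> T (x + d) - cut_log \<delta> T x\<bar> \<le> 1 / 4" .
  have "\<bar>cut_log \<delta> T (x + d) - cut_log \<delta> T x\<bar>\<^sup>2 \<le> (\<bar>m\<bar> / (2 * (1 - \<delta>) * A))\<^sup>2"
    by (intro power_mono le) simp
  also have "\<dots> = m\<^sup>2 / (4 * (1 - \<delta>)\<^sup>2 * A\<^sup>2)"
    by (simp only: power_divide power_mult_distrib power2_abs) simp
  finally show "(cut_log \<delta> T (x + d) - cut_log \<delta> T x)\<^sup>2 \<le>
      (site_sqnorm (x + d) - site_sqnorm x)\<^sup>2 / (4 * (1 - \<delta>)\<^sup>2 * A\<^sup>2)"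
    by (simp add: m_def)
  assume ne: "cut_log \<delta> T (x + d) \<noteq> cut_log \<delta> T x"
  show "site_sqnorm x < 2 * T"
  proof (rule ccontr)
    assume "\<not> site_sqnorm x < 2 * T"
    then have TA: "2 * T \<le> A" by (simp add: A_def add_increasing)
    have "\<delta> * A \<le> A / 2" using \<delta> A by simp
    then have "A / 2 \<le> A + m" using m by (simp add: abs_le_iff)
    then have "T \<le> A" "T \<le> A + m" using TA T by linarith+
    then have "ln T \<le> ln A" "ln T \<le> ln (A + m)" using T by auto
    then show False using ne unfolding cut_log_def Am A_def[symmetric] by simp
  qed
qed

text \<open>The discrete form of \<open>|grad ln|x||\<^sup>2 = 1 / |x|\<^sup>2\<close>. The squared
  increments add up to four times the squared norm plus \<open>a + b + 1 / 2\<close>, and the linear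
  part \<open>a + b\<close> is at most \<open>\<delta> * A\<close>.\<close>

lemma dirichlet_density_cut_log_le:
  assumes \<delta>: "0 < \<delta>" "\<delta> \<le> 1 / 9" and T: "0 < T"
  shows "dirichlet_density (cut_log \<delta> T) x \<le> (1 + \<delta>) / (1 - \<delta>)\<^sup>2 * (1 / (1 + site_sqnorm x))"
proof -
  define A a b where "A = (3 / \<delta>)\<^sup>2 + site_sqnorm x" and "a = real_of_int (fst x)" and "b = real_of_int (snd x)"
  have k: "27 \<le> 3 / \<delta>" using \<delta> by (simp add: field_simps)
  have k2: "729 \<le> (3 / \<delta>)\<^sup>2" using power_mono[OF k, of 2] by simp
  have A: "0 < A" "1 + site_sqnorm x \<le> A" using k2 site_sqnorm_nonneg[of x] unfolding A_def by linarith+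
  have sA: "3 / \<delta> \<le> sqrt A" using k by (intro real_le_rsqrt) (simp add: A_def)
  have "a \<le> sqrt A" "b \<le> sqrt A"
    by (auto intro!: real_le_rsqrt simp: A_def site_sqnorm_def a_def b_def)
  then have "a + b \<le> 2 * sqrt A" by simp
  also have "\<dots> \<le> \<delta> * sqrt A * sqrt A"
    using sA \<delta> A by (intro mult_right_mono) (auto simp: field_simps)
  finally have ab: "a + b \<le> \<delta> * A" using A by (simp add: mult.assoc)
  have steps: "site_sqnorm (x + (1, 0)) - site_sqnorm x = 2 * a + 1" "site_sqnorm (x + (0, 1)) - site_sqnorm x = 2 * b + 1"
    by (auto simp: a_def b_def site_sqnorm_def power2_eq_square algebra_simps)
  have in_steps: "(1, 0) \<in> axis_steps" "(0, 1) \<in> axis_steps" by (auto simp: axis_steps_def)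
  have "dirichlet_density (cut_log \<delta> T) x \<le>
      (2 * a + 1)\<^sup>2 / (4 * (1 - \<delta>)\<^sup>2 * A\<^sup>2) + (2 * b + 1)\<^sup>2 / (4 * (1 - \<delta>)\<^sup>2 * A\<^sup>2)"
    unfolding dirichlet_density_def sum_axis_steps
    using cut_log_step(2)[OF \<delta> in_steps(1) T, of x] cut_log_step(2)[OF \<delta> in_steps(2) T, of x]
    unfolding steps A_def[symmetric] by (rule add_mono)
  also have "\<dots> = (site_sqnorm x + a + b + 1 / 2) / ((1 - \<delta>)\<^sup>2 * A\<^sup>2)"
    using A \<delta> by (simp add: site_sqnorm_def a_def[symmetric] b_def[symmetric] divide_simps)
      (simp add: power2_eq_square algebra_simps)
  also have "\<dots> \<le> ((1 + \<delta>) * A) / ((1 - \<delta>)\<^sup>2 * A\<^sup>2)"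
  proof (rule divide_right_mono)
    have "site_sqnorm x + 1 / 2 \<le> A" using A(2) by linarith
    then show "site_sqnorm x + a + b + 1 / 2 \<le> (1 + \<delta>) * A" using ab by (simp add: algebra_simps)
  qed simp
  also have "\<dots> = (1 + \<delta>) / (1 - \<delta>)\<^sup>2 * (1 / A)"
    using A by (simp add: power2_eq_square)
  also have "\<dots> \<le> (1 + \<delta>) / (1 - \<delta>)\<^sup>2 * (1 / (1 + site_sqnorm x))"
    using A \<delta> by (intro mult_left_mono frac_le) (auto simp: add_pos_nonneg)
  finally show ?thesis .
qed

lemma sum_dirichlet_density_cut_log_le:
  assumes \<delta>: "0 < \<delta>" "\<delta> \<le> 1 / 9" and T: "0 < T" and X: "finite X"
  shows "(\<Sum>x\<in>X. dirichlet_density (cut_log \<delta> T) x) \<le>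
    (1 + \<delta>) / (1 - \<delta>)\<^sup>2 * (\<Sum>x\<in>lattice_disc (nat \<lfloor>2 * T\<rfloor>). 1 / (1 + site_sqnorm x))"
proof -
  define L where "L = lattice_disc (nat \<lfloor>2 * T\<rfloor>)"
  have zero: "dirichlet_density (cut_log \<delta> T) x = 0" if "x \<notin> L" for x
  proof -
    have "2 * T \<le> site_sqnorm x"
    proof (rule ccontr)
      assume less: "\<not> 2 * T \<le> site_sqnorm x"
      have "site_sqnorm x = real_of_int ((fst x)\<^sup>2 + (snd x)\<^sup>2)" by (simp add: site_sqnorm_def)
      with less have "(fst x)\<^sup>2 + (snd x)\<^sup>2 \<le> \<lfloor>2 * T\<rfloor>" by (simp add: le_floor_iff)
      then have "x \<in> L" using T by (simp add: L_def lattice_disc_def)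
      with that show False by simp
    qed
    then have "cut_log \<delta> T (x + d) = cut_log \<delta> T x" if "d \<in> axis_steps" for d
      using cut_log_step(3)[OF \<delta> that T, of x] by linarith
    then show ?thesis by (simp add: dirichlet_density_def)
  qed
  have "(\<Sum>x\<in>X. dirichlet_density (cut_log \<delta> T) x) = (\<Sum>x\<in>X \<inter> L. dirichlet_density (cut_log \<delta> T) x)"
    by (rule sum.mono_neutral_right) (use X zero in auto)
  also have "\<dots> \<le> (\<Sum>x\<in>X \<inter> L. (1 + \<delta>) / (1 - \<delta>)\<^sup>2 * (1 / (1 + site_sqnorm x)))"
    by (rule sum_mono) (rule dirichlet_density_cut_log_le[OF \<delta> T])
  also have "\<dots> \<le> (\<Sum>x\<in>L. (1 + \<delta>) / (1 - \<delta>)\<^sup>2 * (1 / (1 + site_sqnorm x)))"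
    by (rule sum_mono2) (use \<delta> finite_lattice_disc in \<open>auto simp: L_def intro!: mult_nonneg_nonneg divide_nonneg_nonneg\<close>)
  finally show ?thesis by (simp only: L_def sum_distrib_left)
qed

text \<open>The dipole \<open>g = f - f (\<cdot> - v)\<close>. Since \<open>f\<close> vanishes at
  distance \<open>lattice_norm v\<close> from its centre, the gain is \<open>2 * f 0\<close>;
  disjoint gradients make the energy the sum of the two energies, without cross terms.\<close>

lemma log_test_function:
  assumes \<delta>: "0 < \<delta>" "\<delta> \<le> 1 / 9"
  shows "\<exists>C. \<forall>v. v \<noteq> 0 \<longrightarrow> (\<exists>g :: site \<Rightarrow> real.
    2 * ln (lattice_norm v) - C \<le> g 0 - g v \<and>
    (\<forall>x. \<forall>d\<in>axis_steps. \<bar>g (x + d) - g x\<bar> \<le> 1 / 2) \<and>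
    (\<forall>X. finite X \<longrightarrow> (\<Sum>x\<in>X. dirichlet_density g x) \<le> 4 * pi * (1 + 9 * \<delta>) * ln (lattice_norm v) + C))"
proof -
  obtain K where K: "0 \<le> K" "\<And>n. (\<Sum>x\<in>lattice_disc n. 1 / (1 + site_sqnorm x)) \<le> pi * (1 + \<delta>) * ln (real n + 1) + K"
    using sum_lattice_disc_le[OF \<delta>(1)] by blast
  define c where "c = (1 + \<delta>) / (1 - \<delta>)\<^sup>2"
  have c: "0 \<le> c" using \<delta> by (simp add: c_def)
  have c': "c * (1 + \<delta>) \<le> 1 + 9 * \<delta>"
  proof -
    \<comment> \<open>The right-hand side is \<open>(1 + 9 * \<delta>) * (1 - \<delta>)\<^sup>2 - (1
      + \<delta>)\<^sup>2\<close>, arranged so that \<open>\<delta> \<le> 1 / 9\<close> makes each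
      summand nonnegative.\<close>
    have "0 \<le> \<delta> * (3 + 18 * (1 / 9 - \<delta>) + 9 * \<delta>\<^sup>2)"
      using \<delta> by (intro mult_nonneg_nonneg add_nonneg_nonneg) auto
    then have "(1 + \<delta>) * (1 + \<delta>) \<le> (1 + 9 * \<delta>) * (1 - \<delta>)\<^sup>2"
      by (simp add: power2_eq_square algebra_simps)
    then show ?thesis using \<delta> by (simp add: c_def divide_le_eq)
  qed
  \<comment> \<open>The maximum lets one constant serve both the loss in the gain and the bounded
    part of the energy.\<close>
  define C where "C = max (ln 8 + ln ((3 / \<delta>)\<^sup>2)) (2 * (1 + 9 * \<delta>) * pi * ln 2 + 2 * c * K)"
  show ?thesis
  proof (rule exI[of _ C], intro allI impI)
    fix v :: site assume v: "v \<noteq> 0"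
    \<comment> \<open>Gradients live where the squared norm is below \<open>2 * T\<close>, that is
      within half the distance from \<open>0\<close> to \<open>v\<close>; hence the discs around
      \<open>0\<close> and \<open>v\<close> do not meet.\<close>
    define T where "T = site_sqnorm v / 8"
    have sv: "1 \<le> site_sqnorm v" by (rule site_sqnorm_ge_1[OF v])
    have T: "0 < T" using sv by (simp add: T_def)
    have lnv: "ln (site_sqnorm v) = 2 * ln (lattice_norm v)"
      using sv by (simp add: lattice_norm_sqrt ln_sqrt)
    define f where "f = cut_log \<delta> T"
    define g where "g = (\<lambda>x. f x - f (x - v))"
    have zero: "f w = 0" if "site_sqnorm w = site_sqnorm v" for w
    proof -
      have "T \<le> (3 / \<delta>)\<^sup>2 + site_sqnorm w" using that sv by (simp add: T_def add_increasing)
      then have "ln T \<le> ln ((3 / \<delta>)\<^sup>2 + site_sqnorm w)" using T by simp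
      then show ?thesis by (simp add: f_def cut_log_def)
    qed
    have "ln T = 2 * ln (lattice_norm v) - ln 8"
      using sv by (simp add: T_def ln_div lnv)
    then have "(2 * ln (lattice_norm v) - ln 8 - ln ((3 / \<delta>)\<^sup>2)) / 2 \<le> f 0"
      by (simp add: f_def cut_log_def site_sqnorm_def)
    then have "2 * ln (lattice_norm v) - C \<le> 2 * f 0" by (simp add: C_def)
    then have 1: "2 * ln (lattice_norm v) - C \<le> g 0 - g v"
      by (simp add: g_def zero)
    have split: "g (x + d) - g x = (f (x + d) - f x) - (f (x - v + d) - f (x - v))" for x d
      by (simp add: g_def algebra_simps)
    have 2: "\<bar>g (x + d) - g x\<bar> \<le> 1 / 2" if "d \<in> axis_steps" for x d
      using cut_log_step(1)[OF \<delta> that T, of x] cut_log_step(1)[OF \<delta> that T, of "x - v"]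
      unfolding split f_def by linarith
    have disjoint: "f (x + d) - f x = 0 \<or> f (x - v + d) - f (x - v) = 0" if "d \<in> axis_steps" for x d
    proof (rule ccontr)
      assume "\<not> ?thesis"
      then have "site_sqnorm x < 2 * T" "site_sqnorm (x - v) < 2 * T"
        using cut_log_step(3)[OF \<delta> that T, of x] cut_log_step(3)[OF \<delta> that T, of "x - v"] by (auto simp: f_def)
      moreover have "site_sqnorm v \<le> 2 * site_sqnorm x + 2 * site_sqnorm (x - v)"
      proof -
        have "q\<^sup>2 \<le> 2 * p\<^sup>2 + 2 * (p - q)\<^sup>2" for p q :: real
          using zero_le_power2[of "2 * p - q"] by (simp add: power2_eq_square algebra_simps)
        from add_mono[OF this[of "of_int (fst v)" "of_int (fst x)"] this[of "of_int (snd v)" "of_int (snd x)"]]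
        show ?thesis by (simp add: site_sqnorm_def)
      qed
      ultimately show False by (simp add: T_def)
    qed
    have dens: "dirichlet_density g x = dirichlet_density f x + dirichlet_density f (x - v)" for x
      unfolding dirichlet_density_def sum.distrib[symmetric]
    proof (rule sum.cong[OF refl])
      fix d assume "d \<in> axis_steps"
      from disjoint[OF this, of x]
      show "(g (x + d) - g x)\<^sup>2 = (f (x + d) - f x)\<^sup>2 + (f (x - v + d) - f (x - v))\<^sup>2"
        unfolding split by (elim disjE) (simp_all add: power2_commute)
    qed
    have 3: "(\<Sum>x\<in>X. dirichlet_density g x) \<le> 4 * pi * (1 + 9 * \<delta>) * ln (lattice_norm v) + C" if X: "finite X" for X
    proof -
      define S where "S = (\<Sum>x\<in>lattice_disc (nat \<lfloor>2 * T\<rfloor>). 1 / (1 + site_sqnorm x))"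
      have "(\<Sum>x\<in>X. dirichlet_density g x) = (\<Sum>x\<in>X. dirichlet_density f x) + (\<Sum>x\<in>(\<lambda>x. x - v) ` X. dirichlet_density f x)"
        unfolding dens sum.distrib by (subst sum.reindex) (auto simp: inj_on_def)
      also have "\<dots> \<le> c * S + c * S"
        unfolding f_def c_def S_def
        by (intro add_mono sum_dirichlet_density_cut_log_le[OF \<delta> T] X finite_imageI)
      also have "\<dots> \<le> c * (pi * (1 + \<delta>) * (ln 2 + 2 * ln (lattice_norm v)) + K) * 2"
      proof -
        have "real (nat \<lfloor>2 * T\<rfloor>) + 1 \<le> 2 * site_sqnorm v"
          using sv of_int_floor_le[of "2 * T"] T by (simp add: T_def)
        then have "ln (real (nat \<lfloor>2 * T\<rfloor>) + 1) \<le> ln (2 * site_sqnorm v)" by simp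
        also have "\<dots> = ln 2 + 2 * ln (lattice_norm v)" using sv by (simp add: ln_mult lnv)
        finally have "pi * (1 + \<delta>) * ln (real (nat \<lfloor>2 * T\<rfloor>) + 1) \<le> pi * (1 + \<delta>) * (ln 2 + 2 * ln (lattice_norm v))"
          using \<delta> by (intro mult_left_mono) auto
        then have "S \<le> pi * (1 + \<delta>) * (ln 2 + 2 * ln (lattice_norm v)) + K"
          using K(2)[of "nat \<lfloor>2 * T\<rfloor>"] unfolding S_def by linarith
        from mult_left_mono[OF this c] show ?thesis by (simp only: mult_2_right add_mono)
      qed
      also have "\<dots> = (c * (1 + \<delta>)) * (2 * pi * (ln 2 + 2 * ln (lattice_norm v))) + 2 * c * K"
        by (simp add: algebra_simps)
      also have "\<dots> \<le> (1 + 9 * \<delta>) * (2 * pi * (ln 2 + 2 * ln (lattice_norm v))) + 2 * c * K"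
      proof -
        have "0 \<le> ln (lattice_norm v)" using sv lnv ln_ge_zero[OF sv] by simp
        then show ?thesis by (intro add_right_mono mult_right_mono c') (auto intro!: mult_nonneg_nonneg add_nonneg_nonneg)
      qed
      also have "\<dots> \<le> 4 * pi * (1 + 9 * \<delta>) * ln (lattice_norm v) + C"
        by (simp add: C_def algebra_simps max_def)
      finally show ?thesis .
    qed
    show "\<exists>g :: site \<Rightarrow> real. 2 * ln (lattice_norm v) - C \<le> g 0 - g v \<and>
        (\<forall>x. \<forall>d\<in>axis_steps. \<bar>g (x + d) - g x\<bar> \<le> 1 / 2) \<and>
        (\<forall>X. finite X \<longrightarrow> (\<Sum>x\<in>X. dirichlet_density g x) \<le> 4 * pi * (1 + 9 * \<delta>) * ln (lattice_norm v) + C)"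
      using 1 2 3 by blast
  qed
qed


section \<open>Lattice edges and the size of the error function\<close>

lemma lattice_edge_cases:
  assumes "e \<in> lattice_edges"
  shows "\<exists>x d. d \<in> axis_steps \<and> e = {x, x + d}"
proof -
  obtain x y where e: "e = {x, y}" and dist: "\<bar>fst x - fst y\<bar> + \<bar>snd x - snd y\<bar> = 1"
    using assms by (auto simp: lattice_edges_def)
  then have "y - x \<in> axis_steps \<or> x - y \<in> axis_steps"
    unfolding axis_steps_def by (cases x; cases y) (auto simp: abs_if split: if_splits)
  then show ?thesis
  proof
    assume "y - x \<in> axis_steps"
    moreover have "e = {x, x + (y - x)}" by (simp add: e)
    ultimately show ?thesis by blast
  next
    assume "x - y \<in> axis_steps"
    moreover have "e = {y, y + (x - y)}" by (simp add: e insert_commute)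
    ultimately show ?thesis by blast
  qed
qed

text \<open>The factor \<open>36\<close> bounds \<open>(2 * pi)\<^sup>2\<close> from below and
  \<open>1 / 10\<close> comes from \<open>Var_IG_ge\<close>. The upper bound, from
  \<open>b\<^sup>2 \<le> 8 * exp (b / 2)\<close>, keeps the multiplier
  \<open>1 + M_error \<beta> / 2\<close> of the slopes below \<open>2\<close>.\<close>

lemma M_error_bounds:
  assumes \<beta>: "1 \<le> \<beta>"
  shows "36 / 10 * \<beta> * exp (- ((2 * pi)\<^sup>2 / 2) * \<beta>) \<le> M_error \<beta>" and "0 \<le> M_error \<beta>" and "M_error \<beta> \<le> 1"
proof -
  define b where "b = (2 * pi)\<^sup>2 * \<beta>"
  have pi2: "36 \<le> (2 * pi)\<^sup>2" using power_mono[of 6 "2 * pi" 2] pi_gt3 by simp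
  then have b36: "36 * \<beta> \<le> b" using \<beta> by (simp add: b_def)
  then have b: "0 < b" "36 \<le> b" using \<beta> by linarith+
  have r: "exp (- (b / 2)) \<le> 1 / 1000" using exp_neg_pi2_le[OF \<beta>] by (simp add: b_def)
  note V = min_Var_IG_bounds[OF b(1) r]
  have M: "M_error \<beta> = b * min_Var_IG b" by (simp add: M_error_eq b_def)
  have e: "exp (- ((2 * pi)\<^sup>2 / 2) * \<beta>) = exp (- (b / 2))" by (simp add: b_def)
  have "36 * \<beta> * (1 / 10 * exp (- (b / 2))) \<le> b * min_Var_IG b"
    by (intro mult_mono b36 V(1)) (use b in auto)
  then show low: "36 / 10 * \<beta> * exp (- ((2 * pi)\<^sup>2 / 2) * \<beta>) \<le> M_error \<beta>"
    unfolding e M by simp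
  have "0 \<le> 36 / 10 * \<beta> * exp (- ((2 * pi)\<^sup>2 / 2) * \<beta>)" using \<beta> by simp
  with low show "0 \<le> M_error \<beta>" by linarith
  have "(b / 2)\<^sup>2 / 2 \<le> exp (b / 2)"
    using exp_lower_Taylor_quadratic[of "b / 2"] b by simp
  then have "b * b \<le> 8 * exp (b / 2)" by (simp add: power2_eq_square)
  moreover have "36 * b \<le> b * b" using b by (intro mult_right_mono) auto
  ultimately have "36 * b \<le> 8 * exp (b / 2)" by linarith
  then have "b * exp (- (b / 2)) \<le> 8 / 36" by (simp add: exp_minus field_simps)
  moreover have "b * min_Var_IG b \<le> b * (201 / 100 * exp (- (b / 2)))"
    using V(2) b by (intro mult_left_mono) auto
  ultimately show "M_error \<beta> \<le> 1" unfolding M by simp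
qed

section \<open>Decay of correlations\<close>

text \<open>Plays two roles: the decay exponent, and the multiple of the dipole used as shift. The
  exact optimum for energy \<open>4 pi ln |v|\<close> has \<open>1 / (1 - M / 2)\<close> in place of
  \<open>1 + M / 2\<close>; the two agree to first order in \<open>M\<close>, and
  \<open>(1 - M / 2) * (1 + M / 2) \<le> 1\<close> suffices below.\<close>

definition decay_rate :: "real \<Rightarrow> real" where
  "decay_rate \<beta> = (1 + M_error \<beta> / 2) / (2 * pi * \<beta>)"

text \<open>The energy bound over all finite sets makes the estimate independent of
  \<open>n\<close>, as the infinite-volume limit requires.\<close>

lemma villain_box_correlation_le:
  assumes \<beta>: "1 \<le> \<beta>" and v: "v \<in> box n"
    and grad: "\<And>x d. d \<in> axis_steps \<Longrightarrow> \<bar>g (x + d) - g x\<bar> \<le> 1 / 2"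
    and energy: "\<And>X. finite X \<Longrightarrow> (\<Sum>x\<in>X. dirichlet_density g x) \<le> D"
  shows "(\<integral>\<theta>. cos (\<theta> 0 - \<theta> v) \<partial>villain_box n \<beta>) \<le>
    exp (decay_rate \<beta> * (g v - g 0) + \<beta> / 2 * (1 - M_error \<beta> / 2) * ((decay_rate \<beta>)\<^sup>2 * D))"
proof -
  define l E h where "l = decay_rate \<beta>" and "E = {e \<in> lattice_edges. e \<subseteq> box n}" and "h = (\<lambda>x. l * g x)"
  note M = M_error_bounds(2,3)[OF \<beta>]
  have l: "2 * pi * \<beta> * l = 1 + M_error \<beta> / 2" using \<beta> by (simp add: l_def decay_rate_def)
  have box: "finite (box n)" "0 \<in> box n" by (auto simp: box_def zero_prod_def)
  have fin: "finite E" unfolding E_def by (rule finite_subset[of _ "Pow (box n)"]) (use box(1) in auto)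
  have "\<forall>e\<in>E. \<exists>p. snd p \<in> axis_steps \<and> e = {fst p, fst p + snd p}"
  proof
    fix e assume "e \<in> E"
    then have "e \<in> lattice_edges" by (simp add: E_def)
    from lattice_edge_cases[OF this] obtain x d where "d \<in> axis_steps" "e = {x, x + d}" by blast
    then show "\<exists>p. snd p \<in> axis_steps \<and> e = {fst p, fst p + snd p}" by (intro exI[of _ "(x, d)"]) simp
  qed
  from bchoice[OF this] obtain p where
    P: "\<forall>e\<in>E. snd (p e) \<in> axis_steps \<and> e = {fst (p e), fst (p e) + snd (p e)}" ..
  note p = conjunct1[OF bspec[OF P]] conjunct2[OF bspec[OF P]]
  have p_box: "fst (p e) \<in> box n" "fst (p e) + snd (p e) \<in> box n" if "e \<in> E" for e
  proof -
    have "{fst (p e), fst (p e) + snd (p e)} \<subseteq> box n"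
      using that unfolding p(2)[OF that, symmetric] by (simp only: E_def mem_Collect_eq)
    then show "fst (p e) \<in> box n" "fst (p e) + snd (p e) \<in> box n" by auto
  qed
  have "\<bar>\<integral>\<theta>. cos (\<theta> 0 - \<theta> v) \<partial>villain_model (box n) E 0 \<beta>\<bar> \<le>
      exp (h v - h 0 + \<beta> / 2 * (1 - M_error \<beta> / 2) *
        (\<Sum>e\<in>E. (h (fst (p e)) - h (fst (p e) + snd (p e)))\<^sup>2))"
  proof (rule villain_model_correlation_le[OF box v \<beta> fin p(2) p_box])
    fix e assume "e \<in> E"
    from grad[OF p(1)[OF this], of "fst (p e)"]
    have "\<bar>g (fst (p e)) - g (fst (p e) + snd (p e))\<bar> \<le> 1 / 2" by (simp add: abs_minus_commute)
    \<comment> \<open>Here \<open>decay_rate\<close> turns the slope \<open>1 / 2\<close> into an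
      argument at most \<open>1\<close>, the range of the characteristic function estimate.\<close>
    then have "(1 + M_error \<beta> / 2) * \<bar>g (fst (p e)) - g (fst (p e) + snd (p e))\<bar> \<le> 2 * (1 / 2)"
      using M by (intro mult_mono) auto
    moreover have "2 * pi * \<beta> * (h (fst (p e)) - h (fst (p e) + snd (p e))) =
        (1 + M_error \<beta> / 2) * (g (fst (p e)) - g (fst (p e) + snd (p e)))"
      unfolding l[symmetric] h_def by (simp add: algebra_simps)
    ultimately show "\<bar>2 * pi * \<beta> * (h (fst (p e)) - h (fst (p e) + snd (p e)))\<bar> \<le> 1"
      using M by (simp add: abs_mult)
  qed
  also have "(\<Sum>e\<in>E. (h (fst (p e)) - h (fst (p e) + snd (p e)))\<^sup>2) =
      l\<^sup>2 * (\<Sum>e\<in>E. (g (fst (p e) + snd (p e)) - g (fst (p e)))\<^sup>2)"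
    unfolding sum_distrib_left h_def power_mult_distrib[symmetric]
    by (intro sum.cong refl) (simp add: power2_eq_square algebra_simps)
  also have "exp (h v - h 0 + \<beta> / 2 * (1 - M_error \<beta> / 2) * (l\<^sup>2 * (\<Sum>e\<in>E. (g (fst (p e) + snd (p e)) - g (fst (p e)))\<^sup>2))) \<le>
      exp (h v - h 0 + \<beta> / 2 * (1 - M_error \<beta> / 2) * (l\<^sup>2 * D))"
  proof -
    \<comment> \<open>An edge is recovered from its chosen base point and step, so no term of the
      energy is used twice.\<close>
    have inj: "inj_on p E"
    proof (rule inj_onI)
      fix e e' assume e: "e \<in> E" "e' \<in> E" and eq: "p e = p e'"
      have "e = {fst (p e), fst (p e) + snd (p e)}" by (rule p(2)[OF e(1)])
      also have "\<dots> = {fst (p e'), fst (p e') + snd (p e')}" by (simp only: eq)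
      also have "\<dots> = e'" by (rule p(2)[OF e(2), symmetric])
      finally show "e = e'" .
    qed
    have "(\<Sum>e\<in>E. (g (fst (p e) + snd (p e)) - g (fst (p e)))\<^sup>2) =
        (\<Sum>q\<in>p ` E. (g (fst q + snd q) - g (fst q))\<^sup>2)"
      by (subst sum.reindex[OF inj]) simp
    also have "\<dots> \<le> (\<Sum>q\<in>box n \<times> axis_steps. (g (fst q + snd q) - g (fst q))\<^sup>2)"
    proof (rule sum_mono2)
      show "finite (box n \<times> axis_steps)" using box(1) by (simp add: axis_steps_def)
      show "p ` E \<subseteq> box n \<times> axis_steps"
        using p(1) p_box(1) by (intro image_subsetI) (simp add: mem_Times_iff)
    qed simp
    also have "\<dots> = (\<Sum>x\<in>box n. dirichlet_density g x)"
      unfolding dirichlet_density_def sum.cartesian_product by (simp add: case_prod_beta)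
    also have "\<dots> \<le> D" by (rule energy[OF box(1)])
    finally show ?thesis
      using \<beta> M by (intro iffD2[OF exp_le_cancel_iff] add_left_mono mult_left_mono) auto
  qed
  also have "h v - h 0 = l * (g v - g 0)" by (simp add: h_def algebra_simps)
  finally have "\<bar>\<integral>\<theta>. cos (\<theta> 0 - \<theta> v) \<partial>villain_model (box n) E 0 \<beta>\<bar> \<le>
      exp (l * (g v - g 0) + \<beta> / 2 * (1 - M_error \<beta> / 2) * (l\<^sup>2 * D))" .
  then show ?thesis
    unfolding villain_box_def E_def[symmetric] l_def[symmetric] by (rule order_trans[OF abs_ge_self])
qed

lemma spin_correlation_le:
  assumes \<beta>: "1 \<le> \<beta>" and lim: "limit_of_boxes \<beta> \<mu>" and \<rho>: "0 < \<rho>" "\<rho> < 1"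
  shows "\<exists>C. \<forall>v. v \<noteq> 0 \<longrightarrow> spin_correlation \<mu> v \<le> exp (C - \<rho> * decay_rate \<beta> * ln (lattice_norm v))"
proof -
  \<comment> \<open>With this \<open>\<delta>\<close> one has
    \<open>(1 + 9 * \<delta>) - 2 = - \<rho>\<close>, energy against gain.\<close>
  define \<delta> l M where "\<delta> = (1 - \<rho>) / 9" and "l = decay_rate \<beta>" and "M = M_error \<beta>"
  have \<delta>: "0 < \<delta>" "\<delta> \<le> 1 / 9" using \<rho> by (auto simp: \<delta>_def)
  have M: "0 \<le> M" "M \<le> 1" using M_error_bounds[OF \<beta>] by (auto simp: M_def)
  have l: "0 < l" "2 * pi * \<beta> * l = 1 + M / 2"
    using \<beta> M by (auto simp: l_def decay_rate_def M_def add_pos_nonneg)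
  obtain C where C: "\<And>v. v \<noteq> 0 \<Longrightarrow> (\<exists>g :: site \<Rightarrow> real.
    2 * ln (lattice_norm v) - C \<le> g 0 - g v \<and>
    (\<forall>x. \<forall>d\<in>axis_steps. \<bar>g (x + d) - g x\<bar> \<le> 1 / 2) \<and>
    (\<forall>X. finite X \<longrightarrow> (\<Sum>x\<in>X. dirichlet_density g x) \<le> 4 * pi * (1 + 9 * \<delta>) * ln (lattice_norm v) + C))"
    using log_test_function[OF \<delta>] by blast
  define C' where "C' = l * C + \<beta> / 2 * (1 - M / 2) * (l\<^sup>2 * C)"
  show ?thesis
  proof (rule exI[of _ C'], intro allI impI)
    fix v :: site assume v: "v \<noteq> 0"
    define L where "L = ln (lattice_norm v)"
    have L: "0 \<le> L"
      using site_sqnorm_ge_1[OF v] by (simp add: L_def lattice_norm_sqrt)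
    obtain g :: "site \<Rightarrow> real" where g: "2 * L - C \<le> g 0 - g v"
      "\<And>x d. d \<in> axis_steps \<Longrightarrow> \<bar>g (x + d) - g x\<bar> \<le> 1 / 2"
      "\<And>X. finite X \<Longrightarrow> (\<Sum>x\<in>X. dirichlet_density g x) \<le> 4 * pi * (1 + 9 * \<delta>) * L + C"
      using C[OF v] unfolding L_def by blast
    define D where "D = 4 * pi * (1 + 9 * \<delta>) * L + C"
    have "l * (g v - g 0) \<le> l * (C - 2 * L)"
      using g(1) l by (intro mult_left_mono) auto
    then have "l * (g v - g 0) + \<beta> / 2 * (1 - M / 2) * (l\<^sup>2 * D) \<le>
        l * (C - 2 * L) + \<beta> / 2 * (1 - M / 2) * (l\<^sup>2 * D)"
      by linarith
    also have "\<dots> = C' + l * L * ((1 - M / 2) * (2 * pi * \<beta> * l) * (1 + 9 * \<delta>) - 2)"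
      by (simp add: C'_def D_def power2_eq_square algebra_simps)
    also have "\<dots> \<le> C' + l * L * (1 * (1 + 9 * \<delta>) - 2)"
    proof -
      have "(1 - M / 2) * (1 + M / 2) \<le> 1" by (simp add: algebra_simps)
      then show ?thesis
        unfolding l(2) using l(1) L \<delta> by (intro add_left_mono mult_left_mono diff_right_mono mult_right_mono) auto
    qed
    also have "\<dots> = C' - \<rho> * l * L" by (simp add: \<delta>_def field_simps)
    finally have le: "exp (l * (g v - g 0) + \<beta> / 2 * (1 - M / 2) * (l\<^sup>2 * D)) \<le> exp (C' - \<rho> * l * L)"
      by simp
    \<comment> \<open>\<open>limit_of_boxes\<close> tests functions of the phases relative to the
      origin; the correlation is the real part of the phase at \<open>v\<close>.\<close>
    define f :: "(site \<Rightarrow> complex) \<Rightarrow> real" where "f = (\<lambda>z. Re (z v))"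
    have "continuous_on UNIV f"
      unfolding f_def by (intro continuous_intros continuous_on_product_coordinates)
    then have "(\<lambda>n. \<integral>\<theta>. f (\<lambda>x. cis (\<theta> x - \<theta> 0)) \<partial>villain_box n \<beta>)
        \<longlonglongrightarrow> (\<integral>\<theta>. f (\<lambda>x. cis (\<theta> x - \<theta> 0)) \<partial>\<mu>)"
      using lim[unfolded limit_of_boxes_def, rule_format, of "{v}" f] by (simp add: f_def)
    moreover have "f (\<lambda>x. cis (\<theta> x - \<theta> 0)) = cos (\<theta> 0 - \<theta> v)" for \<theta>
      using cos_minus[of "\<theta> v - \<theta> 0"] by (simp add: f_def)
    ultimately have conv: "(\<lambda>n. \<integral>\<theta>. cos (\<theta> 0 - \<theta> v) \<partial>villain_box n \<beta>) \<longlonglongrightarrow> spin_correlation \<mu> v"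
      by (simp add: spin_correlation_def)
    show "spin_correlation \<mu> v \<le> exp (C' - \<rho> * decay_rate \<beta> * ln (lattice_norm v))"
    proof (rule LIMSEQ_le_const2[OF conv], intro exI allI impI)
      fix n assume "nat (max \<bar>fst v\<bar> \<bar>snd v\<bar>) \<le> n"
      then have "v \<in> box n" by (cases v) (auto simp: box_def)
      from order_trans[OF villain_box_correlation_le[OF \<beta> this g(2,3)] le[unfolded D_def l_def M_def]]
      show "(\<integral>\<theta>. cos (\<theta> 0 - \<theta> v) \<partial>villain_box n \<beta>) \<le> exp (C' - \<rho> * decay_rate \<beta> * ln (lattice_norm v))"
        by (simp only: L_def)
    qed
  qed
qed


section \<open>Passage to the limit superior\<close>

abbreviation at_infinite_distance :: "site filter" where
  "at_infinite_distance \<equiv> filtercomap lattice_norm at_top"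

lemma at_infinite_distance_neq_bot: "at_infinite_distance \<noteq> bot"
proof (rule filtercomap_neq_bot)
  fix P :: "real \<Rightarrow> bool" assume "eventually P at_top"
  then obtain N where N: "\<And>x. N \<le> x \<Longrightarrow> P x" by (auto simp: eventually_at_top_linorder)
  have "lattice_norm (int (nat \<lceil>N\<rceil>), 0) = real (nat \<lceil>N\<rceil>)" by (simp add: lattice_norm_def)
  moreover have "N \<le> real (nat \<lceil>N\<rceil>)" by linarith
  ultimately show "\<exists>v. P (lattice_norm v)" using N by metis
qed

lemma ln_lattice_norm_at_top: "filterlim (\<lambda>v. ln (lattice_norm v)) at_top at_infinite_distance"
  by (rule filterlim_compose[OF ln_at_top filterlim_filtercomap])

lemma eventually_nonzero_site: "eventually (\<lambda>v. v \<noteq> 0) at_infinite_distance"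
proof -
  have "eventually (\<lambda>v. 1 \<le> lattice_norm v) at_infinite_distance"
    by (intro eventually_filtercomapI eventually_ge_at_top)
  then show ?thesis
    by eventually_elim (auto simp: lattice_norm_def)
qed

lemma tendsto_ratio_affine:
  fixes a c :: real
  assumes "0 < a" and "filterlim L at_top F"
  shows "((\<lambda>v. L v / (a * L v - c)) \<longlongrightarrow> 1 / a) F"
proof (rule filterlim_compose[OF _ assms(2)])
  have "((\<lambda>x. x / (a * x - c)) \<longlongrightarrow> inverse a) at_top"
    using assms(1) by real_asymp
  then show "((\<lambda>x. x / (a * x - c)) \<longlongrightarrow> 1 / a) at_top"
    by (simp add: inverse_eq_divide)
qed

lemma limsup_ratio_le:
  fixes f L :: "'a \<Rightarrow> real"
  assumes a: "0 < a" and L: "filterlim L at_top F" and F: "F \<noteq> bot"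
    and f: "eventually (\<lambda>v. a * L v - c \<le> f v) F"
  shows "Limsup F (\<lambda>v. ereal (L v / f v)) \<le> ereal (1 / a)"
proof -
  have "eventually (\<lambda>v. max 0 (c / a) < L v) F"
    using L unfolding filterlim_at_top_dense by blast
  with f have "eventually (\<lambda>v. ereal (L v / f v) \<le> ereal (L v / (a * L v - c))) F"
  proof eventually_elim
    case (elim v)
    then have "0 < L v" "0 < a * L v - c" using a by (auto simp: field_simps)
    with elim(1) show ?case by (auto intro!: frac_le)
  qed
  then have "Limsup F (\<lambda>v. ereal (L v / f v)) \<le> Limsup F (\<lambda>v. ereal (L v / (a * L v - c)))"
    by (rule Limsup_mono)
  also have "\<dots> = ereal (1 / a)"
    by (rule lim_imp_Limsup[OF F]) (use tendsto_ratio_affine[OF a L, of c] in simp)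
  finally show ?thesis .
qed

lemma limsup_ratio_ge:
  fixes f L :: "'a \<Rightarrow> real"
  assumes a: "0 < a" and L: "filterlim L at_top F" and F: "F \<noteq> bot"
    and f: "eventually (\<lambda>v. f v \<le> a * L v + c) F" "eventually (\<lambda>v. 0 < f v) F"
  shows "ereal (1 / a) \<le> Limsup F (\<lambda>v. ereal (L v / f v))"
proof -
  have "eventually (\<lambda>v. 0 < L v) F"
    using L by (auto simp: filterlim_at_top_dense)
  with f have "eventually (\<lambda>v. ereal (L v / (a * L v - (- c))) \<le> ereal (L v / f v)) F"
    by eventually_elim (auto intro!: frac_le)
  then have "Limsup F (\<lambda>v. ereal (L v / (a * L v - (- c)))) \<le> Limsup F (\<lambda>v. ereal (L v / f v))"
    by (rule Limsup_mono)
  moreover have "Limsup F (\<lambda>v. ereal (L v / (a * L v - (- c)))) = ereal (1 / a)"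
    by (rule lim_imp_Limsup[OF F]) (use tendsto_ratio_affine[OF a L, of "- c"] in simp)
  ultimately show ?thesis by simp
qed

lemma neg_ln_spin_correlation_ge:
  assumes \<beta>: "1 \<le> \<beta>" and lim: "limit_of_boxes \<beta> \<mu>" and \<rho>: "0 < \<rho>" "\<rho> < 1"
    and pos: "\<And>v. v \<noteq> 0 \<Longrightarrow> 0 < spin_correlation \<mu> v"
  shows "\<exists>C. eventually (\<lambda>v. \<rho> * decay_rate \<beta> * ln (lattice_norm v) - C \<le> ln (inverse (spin_correlation \<mu> v)))
    at_infinite_distance"
proof -
  obtain C where C: "\<And>v. v \<noteq> 0 \<Longrightarrow> spin_correlation \<mu> v \<le> exp (C - \<rho> * decay_rate \<beta> * ln (lattice_norm v))"
    using spin_correlation_le[OF \<beta> lim \<rho>] by blast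
  have "eventually (\<lambda>v. \<rho> * decay_rate \<beta> * ln (lattice_norm v) - C \<le> ln (inverse (spin_correlation \<mu> v)))
    at_infinite_distance"
    using eventually_nonzero_site
  proof eventually_elim
    case (elim v)
    then have "ln (spin_correlation \<mu> v) \<le> C - \<rho> * decay_rate \<beta> * ln (lattice_norm v)"
      using C[OF elim] pos[OF elim] by (metis exp_gt_zero ln_exp ln_le_cancel_iff)
    then show ?case using pos[OF elim] by (simp add: ln_inverse)
  qed
  then show ?thesis by blast
qed

lemma decay_rate_pos: "1 \<le> \<beta> \<Longrightarrow> 0 < decay_rate \<beta>"
  using M_error_bounds(2)[of \<beta>] by (simp add: decay_rate_def add_pos_nonneg)

lemma effective_inverse_temperature_le:
  assumes \<beta>: "1 \<le> \<beta>" and lim: "limit_of_boxes \<beta> \<mu>"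
    and pos: "\<And>v. v \<noteq> 0 \<Longrightarrow> 0 < spin_correlation \<mu> v"
  shows "effective_inverse_temperature \<mu> \<le> ereal (\<beta> / (1 + M_error \<beta> / 2))"
proof -
  define l where "l = decay_rate \<beta>"
  define S where "S = Limsup at_infinite_distance (\<lambda>v. ereal (ln (lattice_norm v) / ln (inverse (spin_correlation \<mu> v))))"
  have l: "0 < l" using decay_rate_pos[OF \<beta>] by (simp add: l_def)
  have le: "S \<le> ereal (1 / (\<rho> * l))" if \<rho>: "0 < \<rho>" "\<rho> < 1" for \<rho>
  proof -
    obtain C where "eventually (\<lambda>v. \<rho> * l * ln (lattice_norm v) - C \<le> ln (inverse (spin_correlation \<mu> v))) at_infinite_distance"
      using neg_ln_spin_correlation_ge[OF \<beta> lim \<rho> pos] by (auto simp: l_def)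
    then show ?thesis
      unfolding S_def using \<rho> l
      by (intro limsup_ratio_le ln_lattice_norm_at_top at_infinite_distance_neq_bot) auto
  qed
  have "S \<le> ereal (1 / (1 * l))"
  \<comment> \<open>The additive constant depends on \<open>\<rho>\<close>, but \<open>S\<close>
    does not, so \<open>\<rho>\<close> may tend to \<open>1\<close> only after the limit
    superior.\<close>
  proof (rule tendsto_lowerbound)
    show "((\<lambda>\<rho>. ereal (1 / (\<rho> * l))) \<longlongrightarrow> ereal (1 / (1 * l))) (at_left 1)"
      using l by (intro tendsto_intros) auto
    have "eventually (\<lambda>\<rho>::real. \<rho> \<in> {0<..<1}) (at_left 1)"
      by (rule eventually_at_leftI[of 0]) auto
    then show "eventually (\<lambda>\<rho>. S \<le> ereal (1 / (\<rho> * l))) (at_left 1)"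
      by eventually_elim (auto intro: le)
  qed simp
  then have "ereal (1 / (2 * pi)) * S \<le> ereal (1 / (2 * pi)) * ereal (1 / (1 * l))"
    by (rule ereal_mult_left_mono) simp
  also have "\<dots> = ereal (\<beta> / (1 + M_error \<beta> / 2))"
    using \<beta> by (simp add: l_def decay_rate_def)
  finally show ?thesis by (simp add: effective_inverse_temperature_def S_def)
qed

lemma effective_inverse_temperature_ge:
  assumes \<beta>: "1 \<le> \<beta>" and lim: "limit_of_boxes \<beta> \<mu>" and e: "0 < 1 + e" and K: "0 < K"
    and lower: "\<And>v. v \<noteq> 0 \<Longrightarrow>
      inverse K * lattice_norm v powr (- ((1 + e) / (2 * pi * \<beta>))) \<le> spin_correlation \<mu> v"
    and pos: "\<And>v. v \<noteq> 0 \<Longrightarrow> 0 < spin_correlation \<mu> v"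
  shows "ereal (\<beta> / (1 + e)) \<le> effective_inverse_temperature \<mu>"
proof -
  define p where "p = (1 + e) / (2 * pi * \<beta>)"
  have p: "0 < p" using \<beta> e by (simp add: p_def)
  have l: "0 < 1 / 2 * decay_rate \<beta>" using decay_rate_pos[OF \<beta>] by simp
  have upper: "eventually (\<lambda>v. ln (inverse (spin_correlation \<mu> v)) \<le> p * ln (lattice_norm v) + ln K) at_infinite_distance"
    using eventually_nonzero_site
  proof eventually_elim
    case (elim v)
    have norm: "0 < lattice_norm v" using site_sqnorm_ge_1[OF elim] by (simp add: lattice_norm_sqrt)
    have "ln (inverse K * lattice_norm v powr (- p)) \<le> ln (spin_correlation \<mu> v)"
      using lower[OF elim] pos[OF elim] K norm by (simp add: p_def)
    then show ?case
      using K norm pos[OF elim] by (simp add: ln_mult ln_inverse ln_powr)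
  qed
  \<comment> \<open>The lower bound on correlations bounds the denominator from above only. Its
    eventual positivity, needed to invert, follows from decay at any positive rate;
    \<open>1 / 2\<close> is an arbitrary choice of \<open>\<rho>\<close>.\<close>
  obtain C where C: "eventually (\<lambda>v. 1 / 2 * decay_rate \<beta> * ln (lattice_norm v) - C \<le> ln (inverse (spin_correlation \<mu> v)))
      at_infinite_distance"
    using neg_ln_spin_correlation_ge[OF \<beta> lim, of "1 / 2"] pos by auto
  have "eventually (\<lambda>v. C / (1 / 2 * decay_rate \<beta>) < ln (lattice_norm v)) at_infinite_distance"
    using ln_lattice_norm_at_top by (auto simp: filterlim_at_top_dense)
  with C have "eventually (\<lambda>v. 0 < ln (inverse (spin_correlation \<mu> v))) at_infinite_distance"
  proof eventually_elim
    case (elim v)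
    from elim(2) have "C < 1 / 2 * decay_rate \<beta> * ln (lattice_norm v)"
      unfolding pos_divide_less_eq[OF l] by (simp only: mult_ac)
    with elim(1) show ?case by linarith
  qed
  with upper have "ereal (1 / p) \<le> Limsup at_infinite_distance (\<lambda>v. ereal (ln (lattice_norm v) / ln (inverse (spin_correlation \<mu> v))))"
    by (intro limsup_ratio_ge[OF p ln_lattice_norm_at_top at_infinite_distance_neq_bot])
  then have "ereal (1 / (2 * pi)) * ereal (1 / p) \<le> effective_inverse_temperature \<mu>"
    unfolding effective_inverse_temperature_def by (rule ereal_mult_left_mono) simp
  then show ?thesis using \<beta> by (simp add: p_def)
qed

theorem corollary1p7:
  fixes \<mu> :: "real \<Rightarrow> (site \<Rightarrow> real) measure" and \<epsilon> :: "real \<Rightarrow> real"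
  assumes "\<And>\<beta>. \<beta> > 0 \<Longrightarrow> villain_state \<beta> (\<mu> \<beta>)"
    and "frohlich_spencer_function \<mu> \<epsilon>"
  shows "\<exists>\<beta>\<^sub>1. \<forall>\<beta>\<ge>\<beta>\<^sub>1.
    ereal (\<beta> / (1 + \<epsilon> \<beta>)) \<le> effective_inverse_temperature (\<mu> \<beta>) \<and>
    effective_inverse_temperature (\<mu> \<beta>) \<le> ereal (\<beta> / (1 + M_error \<beta> / 2)) \<and>
    \<beta> / (1 + M_error \<beta> / 2) \<le> \<beta> - 1 / 2 * \<beta>\<^sup>2 * exp (- ((2 * pi)\<^sup>2 / 2) * \<beta>)"
proof -
  obtain \<beta>\<^sub>0 where \<beta>\<^sub>0: "\<And>\<beta>. \<beta>\<^sub>0 \<le> \<beta> \<Longrightarrow> \<exists>K>0. \<forall>v. v \<noteq> 0 \<longrightarrow>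
      spin_correlation (\<mu> \<beta>) v \<ge> inverse K * lattice_norm v powr (- ((1 + \<epsilon> \<beta>) / (2 * pi * \<beta>)))"
    using assms(2) by (auto simp: frohlich_spencer_function_def)
  have "eventually (\<lambda>\<beta>. - 1 < \<epsilon> \<beta>) at_top"
    using assms(2) by (intro order_tendstoD(1)[of \<epsilon> 0]) (auto simp: frohlich_spencer_function_def)
  then obtain \<beta>\<^sub>2 where \<beta>\<^sub>2: "\<And>\<beta>. \<beta>\<^sub>2 \<le> \<beta> \<Longrightarrow> - 1 < \<epsilon> \<beta>"
    by (auto simp: eventually_at_top_linorder)
  show ?thesis
  proof (intro exI[of _ "max 1 (max \<beta>\<^sub>0 \<beta>\<^sub>2)"] allI impI conjI)
    fix \<beta> assume "max 1 (max \<beta>\<^sub>0 \<beta>\<^sub>2) \<le> \<beta>"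
    then have \<beta>: "1 \<le> \<beta>" "\<beta>\<^sub>0 \<le> \<beta>" "\<beta>\<^sub>2 \<le> \<beta>" by auto
    have lim: "limit_of_boxes \<beta> (\<mu> \<beta>)"
      using assms(1)[of \<beta>] \<beta>(1) by (simp add: villain_state_def)
    obtain K where K: "0 < K" "\<And>v. v \<noteq> 0 \<Longrightarrow>
        inverse K * lattice_norm v powr (- ((1 + \<epsilon> \<beta>) / (2 * pi * \<beta>))) \<le> spin_correlation (\<mu> \<beta>) v"
      using \<beta>\<^sub>0[OF \<beta>(2)] by blast
    have pos: "0 < spin_correlation (\<mu> \<beta>) v" if "v \<noteq> 0" for v
    proof -
      have "0 < lattice_norm v" using site_sqnorm_ge_1[OF that] by (simp add: lattice_norm_sqrt)
      then have "0 < inverse K * lattice_norm v powr (- ((1 + \<epsilon> \<beta>) / (2 * pi * \<beta>)))" using K(1) by simp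
      then show ?thesis using K(2)[OF that] by linarith
    qed
    show "ereal (\<beta> / (1 + \<epsilon> \<beta>)) \<le> effective_inverse_temperature (\<mu> \<beta>)"
      using \<beta>\<^sub>2[OF \<beta>(3)] by (intro effective_inverse_temperature_ge[OF \<beta>(1) lim _ K pos]) auto
    show "effective_inverse_temperature (\<mu> \<beta>) \<le> ereal (\<beta> / (1 + M_error \<beta> / 2))"
      by (rule effective_inverse_temperature_le[OF \<beta>(1) lim pos])
    define M X where "M = M_error \<beta>" and "X = \<beta> * exp (- ((2 * pi)\<^sup>2 / 2) * \<beta>)"
    have X: "0 \<le> X" "36 / 10 * X \<le> M" "M \<le> 1"
      using M_error_bounds[OF \<beta>(1)] \<beta>(1) by (auto simp: M_def X_def)
    \<comment> \<open>With \<open>1 + M / 2 \<le> 2\<close> and \<open>36 / 10 * X \<le> M\<close>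
      the product stays below \<open>M / 2\<close>, which is the claim after clearing the
      denominator.\<close>
    have "1 / 2 * X * (1 + M / 2) \<le> 1 / 2 * X * 2" using X by (intro mult_left_mono) auto
    then have "1 / 2 * X * (1 + M / 2) \<le> M / 2" using X by linarith
    then have "1 \<le> (1 - 1 / 2 * X) * (1 + M / 2)" by (simp add: algebra_simps)
    then have "\<beta> * 1 \<le> \<beta> * ((1 - 1 / 2 * X) * (1 + M / 2))" using \<beta>(1) by (intro mult_left_mono) auto
    then have "\<beta> / (1 + M / 2) \<le> \<beta> * (1 - 1 / 2 * X)"
      using X by (simp add: pos_divide_le_eq mult.assoc)
    also have "\<dots> = \<beta> - 1 / 2 * \<beta>\<^sup>2 * exp (- ((2 * pi)\<^sup>2 / 2) * \<beta>)"
      by (simp add: X_def power2_eq_square algebra_simps)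
    finally show "\<beta> / (1 + M_error \<beta> / 2) \<le> \<beta> - 1 / 2 * \<beta>\<^sup>2 * exp (- ((2 * pi)\<^sup>2 / 2) * \<beta>)"
      by (simp only: M_def)
  qed
qed

end
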